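(* (1) Let $n\geq 5$. There exists a strongly hypoenergetic tree of order $n$ with maximum degree $4$ if and only if $n\in\{9,13,17,20,21\}$ or $n\geq 23$. (2) Let $n\geq 6$. There exists a strongly hypoenergetic tree of order $n$ with maximum degree $5$ if and only if $n=6$ or $n\geq 9$. (3) For every integer $\Delta\geq 6$ and every $n\geq\Delta+1$, there exists a strongly hypoenergetic tree of order $n$ with maximum degree $\Delta$.
   Context: All graphs are finite and simple. The energy of a graph $G$ is $E(G)=\sum_{i=1}^n |\lambda_i|$, where $\lambda_1,\dots,\lambda_n$ are the eigenvalues of the adjacency matrix of $G$. A connected graph $G$ with $n$ vertices is called strongly hypoenergetic if $E(G)<n-1$. *)

theory Defs
  imports "Jordan_Normal_Form.Char_Poly" "HOL-Computational_Algebra.Polynomial"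
begin

definition simple_graph :: "nat \<Rightarrow> (nat \<Rightarrow> nat \<Rightarrow> bool) \<Rightarrow> bool" where
  "simple_graph n E \<longleftrightarrow>
     (\<forall>u v. E u v \<longrightarrow> u < n \<and> v < n) \<and>
     (\<forall>u v. E u v \<longrightarrow> E v u) \<and>
     (\<forall>v. \<not> E v v)"

definition connected_graph :: "nat \<Rightarrow> (nat \<Rightarrow> nat \<Rightarrow> bool) \<Rightarrow> bool" where
  "connected_graph n E \<longleftrightarrow> (\<forall>u<n. \<forall>v<n. E\<^sup>*\<^sup>* u v)"

definition is_cycle :: "(nat \<Rightarrow> nat \<Rightarrow> bool) \<Rightarrow> nat list \<Rightarrow> bool" where
  "is_cycle E vs \<longleftrightarrow> length vs \<ge> 3 \<and> distinct vs \<and>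
     (\<forall>i. Suc i < length vs \<longrightarrow> E (vs ! i) (vs ! Suc i)) \<and>
     E (last vs) (hd vs)"

definition is_tree :: "nat \<Rightarrow> (nat \<Rightarrow> nat \<Rightarrow> bool) \<Rightarrow> bool" where
  "is_tree n E \<longleftrightarrow> simple_graph n E \<and> connected_graph n E \<and> (\<nexists>vs. is_cycle E vs)"

definition degree :: "nat \<Rightarrow> (nat \<Rightarrow> nat \<Rightarrow> bool) \<Rightarrow> nat \<Rightarrow> nat" where
  "degree n E v = card {u. u < n \<and> E v u}"

definition max_degree :: "nat \<Rightarrow> (nat \<Rightarrow> nat \<Rightarrow> bool) \<Rightarrow> nat" where
  "max_degree n E = Max (degree n E ` {0..<n})"

definition adjacency_matrix :: "nat \<Rightarrow> (nat \<Rightarrow> nat \<Rightarrow> bool) \<Rightarrow> complex mat" where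
  "adjacency_matrix n E = mat n n (\<lambda>(i, j). if E i j then 1 else 0)"

definition energy :: "nat \<Rightarrow> (nat \<Rightarrow> nat \<Rightarrow> bool) \<Rightarrow> real" where
  "energy n E = sum_mset (image_mset cmod (proots (char_poly (adjacency_matrix n E))))"

definition strongly_hypoenergetic :: "nat \<Rightarrow> (nat \<Rightarrow> nat \<Rightarrow> bool) \<Rightarrow> bool" where
  "strongly_hypoenergetic n E \<longleftrightarrow> simple_graph n E \<and> connected_graph n E \<and>
     energy n E < real n - 1"

end

theory Submission
  imports Defs "HOL-Combinatorics.Cycles" "HOL-Real_Asymp.Real_Asymp"
begin

text \<open>
  For a tree with eigenvalues \<open>\<lambda>\<close> and \<open>M(t) = \<Sum> m\<^sub>k t\<^bsup>2k\<^esup>\<close>, where \<open>m\<^sub>k\<close> counts the matchings with \<open>k\<close> edges, one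
  has \<open>\<Prod> (1 + t\<^sup>2 \<lambda>\<^sup>2) = M(t)\<^sup>2\<close>. By Coulson's integral formula, a bound on \<open>M\<close> by a product
  \<open>\<Prod> (1 + t\<^sup>2 b\<^sup>2)\<close>, valid for all \<open>t > 0\<close>, bounds the energy by \<open>2 \<Sum> b\<close> in the same direction.

  Gluing a star with \<open>k\<close> edges at a leaf multiplies \<open>M\<close> by at most \<open>1 + k t\<^sup>2\<close>, hence adds at most
  \<open>2 sqrt k\<close> to the energy. As the star with 4 edges adds 4 vertices and energy at most 4, it is enough to
  find one tree per residue class modulo 4.

  For nonexistence, \<open>M\<close> satisfies a recursion under joining two rooted trees by an edge between the roots
  that is monotone in the coefficients. Keeping only the coefficientwise minimal pairs (tree, tree without
  root) leaves a few candidates per order, and the remaining orders are settled by a finite computation.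
\<close>

text \<open>A star with \<open>k\<close> edges adds \<open>k\<close> to the order and at most
  \<open>2 * sqrt k\<close> to the energy, so gluing it changes the slack \<open>n - 1 - E\<close>
  by at least \<open>k - 2 * sqrt k\<close>, and \<open>k = 4\<close> is the break-even point. For
  maximum degree \<Delta> \<ge> 6 the star itself has enough slack to pay for one further star with
  at most 3 edges, which fills all residue classes. For degree 5 the slack is thinner and two orders
  are lost. For degree 4 the star has slack 0, so the bases must be larger trees, and most
  exceptional orders come from there. No eigenvalue is ever computed: rational numbers
  \<open>b\<close> stand in for the positive ones, and a bound on \<open>M\<close> becomes a
  comparison of integer coefficients. Pairs are needed since a matching that uses the joining edge
  leaves both trees without their roots. The coefficientwise order on pairs is only partial, so
  several candidates can survive for one order, and one certificate must lie below all of
  them.\<close>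

section \<open>Coulson's comparison principle\<close>

text \<open>The antiderivative of \<open>ln (1 + a\<^sup>2 / s\<^sup>2)\<close> behind Coulson's formula
  \<open>\<bar>a\<bar> = (1 / pi) * \<integral> ln (1 + a\<^sup>2 / s\<^sup>2) ds\<close>; working with it avoids the improper integral.\<close>

definition coulson :: "real \<Rightarrow> real \<Rightarrow> real" where
  "coulson a s = s * ln (1 + a\<^sup>2 / s\<^sup>2) + 2 * a * arctan (s / a)"

lemma coulson_zero [simp]: "coulson 0 = (\<lambda>s. 0)"
  by (simp add: coulson_def[abs_def])

lemma coulson_has_derivative:
  assumes "s > 0"
  shows "(coulson a has_real_derivative ln (1 + a\<^sup>2 / s\<^sup>2)) (at s)"
proof (cases "a = 0")
  case True
  then show ?thesis by simp
next
  case False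
  have pos: "0 < 1 + a\<^sup>2 / s\<^sup>2" by (simp add: add_pos_nonneg)
  have pos': "0 < s\<^sup>2 + a\<^sup>2" using assms by (simp add: add_pos_nonneg)
  have "(coulson a has_real_derivative
      ln (1 + a\<^sup>2 / s\<^sup>2) + s * ((- 2 * a\<^sup>2 / s ^ 3) / (1 + a\<^sup>2 / s\<^sup>2)) + 2 * a * (inverse (1 + (s / a)\<^sup>2) * (1 / a))) (at s)"
    unfolding coulson_def[abs_def]
    by (rule derivative_eq_intros refl pos | use assms False in \<open>simp; fail\<close>)+
      (use assms False in \<open>simp add: power2_eq_square power3_eq_cube mult_ac\<close>)
  moreover have "s * ((- 2 * a\<^sup>2 / s ^ 3) / (1 + a\<^sup>2 / s\<^sup>2)) = - 2 * a\<^sup>2 / (s\<^sup>2 + a\<^sup>2)"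
    using assms pos pos' by (simp add: divide_simps power2_eq_square power3_eq_cube)
  moreover have "2 * a * (inverse (1 + (s / a)\<^sup>2) * (1 / a)) = 2 * a\<^sup>2 / (s\<^sup>2 + a\<^sup>2)"
  proof -
    have "1 + (s / a)\<^sup>2 = (s\<^sup>2 + a\<^sup>2) / a\<^sup>2"
      using False by (simp add: field_simps power2_eq_square)
    then show ?thesis using False by (simp add: field_simps power2_eq_square)
  qed
  ultimately show ?thesis by simp
qed

lemma coulson_at_right_0: "(coulson a \<longlongrightarrow> 0) (at_right 0)"
proof (cases "a = 0")
  case False
  have 1: "((\<lambda>s. s * ln (1 + b / s\<^sup>2)) \<longlongrightarrow> 0) (at_right 0)" if "b > 0" for b :: real
    using that by real_asymp
  have 2: "((\<lambda>s. 2 * a * arctan (s / a)) \<longlongrightarrow> 2 * a * arctan (0 / a)) (at_right 0)"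
    using False by (intro tendsto_intros) auto
  show ?thesis
    unfolding coulson_def using tendsto_add[OF 1 2, of "a\<^sup>2"] False by simp
qed simp

lemma coulson_at_top: "(coulson a \<longlongrightarrow> pi * \<bar>a\<bar>) at_top"
proof (cases "a = 0")
  case False
  have 1: "((\<lambda>s. s * ln (1 + b / s\<^sup>2)) \<longlongrightarrow> 0) at_top" if "b > 0" for b :: real
    using that by real_asymp
  have 3: "((\<lambda>s. 2 * b * arctan (s / b)) \<longlongrightarrow> pi * b) at_top" if "b > 0" for b :: real
    using that by real_asymp
  \<comment> \<open>The arctangent is odd, so only a positive parameter reaches
    \<open>real_asymp\<close>.\<close>
  have even: "2 * a * arctan (s / a) = 2 * \<bar>a\<bar> * arctan (s / \<bar>a\<bar>)" for s
    by (cases "a \<ge> 0") (simp_all add: arctan_minus)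
  show ?thesis
    unfolding coulson_def even using tendsto_add[OF 1 3, of "a\<^sup>2" "\<bar>a\<bar>"] False by simp
qed simp

text \<open>With \<open>y = 1 / s^2\<close>, the logarithms of the two products are the derivatives
  of sums of \<open>coulson\<close> terms. The difference \<open>G\<close> of these sums is
  therefore nondecreasing on the positive axis, with limit 0 at 0 and limit \<open>pi\<close> times
  the difference of the two sides at infinity.\<close>

lemma sum_abs_le_of_prod_le:
  fixes A B :: "real list"
  assumes le: "\<And>y. y > 0 \<Longrightarrow> (\<Prod>a\<leftarrow>A. 1 + y * a\<^sup>2) \<le> (\<Prod>b\<leftarrow>B. 1 + y * b\<^sup>2)"
  shows "(\<Sum>a\<leftarrow>A. \<bar>a\<bar>) \<le> (\<Sum>b\<leftarrow>B. \<bar>b\<bar>)"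
proof -
  define H where "H L s = (\<Sum>a\<leftarrow>L. coulson a s)" for L s
  have pos: "(\<Prod>a\<leftarrow>L. 1 + y * a\<^sup>2) > 0" if "y > 0" for L and y :: real
    using that by (induction L) (auto intro!: mult_pos_pos add_pos_nonneg)
  have deriv: "(H L has_real_derivative ln (\<Prod>a\<leftarrow>L. 1 + inverse (s\<^sup>2) * a\<^sup>2)) (at s)" if s: "s > 0" for L s
  proof (induction L)
    case (Cons a L)
    have "0 < 1 + inverse (s\<^sup>2) * a\<^sup>2" by (simp add: add_pos_nonneg)
    then have "ln (\<Prod>a\<leftarrow>a # L. 1 + inverse (s\<^sup>2) * a\<^sup>2)
        = ln (1 + a\<^sup>2 / s\<^sup>2) + ln (\<Prod>a\<leftarrow>L. 1 + inverse (s\<^sup>2) * a\<^sup>2)"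
      using pos[of "inverse (s\<^sup>2)" L] s by (simp add: ln_mult_pos divide_inverse mult.commute)
    then show ?case
      using DERIV_add[OF coulson_has_derivative[OF s, of a] Cons] by (simp add: H_def[abs_def])
  qed (simp add: H_def[abs_def])
  have lim0: "(H L \<longlongrightarrow> 0) (at_right 0)" for L
  proof (induction L)
    case (Cons a L)
    then show ?case using tendsto_add[OF coulson_at_right_0[of a] Cons] by (simp add: H_def[abs_def])
  qed (simp add: H_def[abs_def])
  have lim1: "(H L \<longlongrightarrow> pi * (\<Sum>a\<leftarrow>L. \<bar>a\<bar>)) at_top" for L
  proof (induction L)
    case (Cons a L)
    then show ?case using tendsto_add[OF coulson_at_top[of a] Cons] by (simp add: H_def[abs_def] algebra_simps)
  qed (simp add: H_def[abs_def])
  define G where "G s = H B s - H A s" for s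
  have mono: "G s \<le> G t" if "0 < s" "s \<le> t" for s t
  proof (rule DERIV_nonneg_imp_nondecreasing[OF that(2)])
    fix x assume "s \<le> x" "x \<le> t"
    then have x: "x > 0" using that by simp
    then have y: "inverse (x\<^sup>2) > 0" by simp
    have "ln (\<Prod>a\<leftarrow>A. 1 + inverse (x\<^sup>2) * a\<^sup>2) \<le> ln (\<Prod>a\<leftarrow>B. 1 + inverse (x\<^sup>2) * a\<^sup>2)"
      using le[OF y] pos[OF y] by (subst ln_le_cancel_iff) auto
    then show "\<exists>y. DERIV G x :> y \<and> y \<ge> 0"
      using DERIV_diff[OF deriv[OF x, of B] deriv[OF x, of A]] by (auto simp: G_def[abs_def])
  qed
  have G0: "(G \<longlongrightarrow> 0) (at_right 0)"
    using tendsto_diff[OF lim0[of B] lim0[of A]] by (simp add: G_def[abs_def])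
  have "G t \<ge> 0" if "t > 0" for t
  proof (rule tendsto_le[OF _ tendsto_const G0])
    show "\<forall>\<^sub>F s in at_right 0. G s \<le> G t"
      using that mono by (auto simp: eventually_at_right_field intro!: exI[of _ t])
  qed simp
  then have "\<forall>\<^sub>F t in at_top. 0 \<le> G t"
    by (intro eventually_mono[OF eventually_gt_at_top[of "0::real"]])
  moreover have "(G \<longlongrightarrow> pi * (\<Sum>b\<leftarrow>B. \<bar>b\<bar>) - pi * (\<Sum>a\<leftarrow>A. \<bar>a\<bar>)) at_top"
    using tendsto_diff[OF lim1[of B] lim1[of A]] by (simp add: G_def[abs_def])
  ultimately have "0 \<le> pi * (\<Sum>b\<leftarrow>B. \<bar>b\<bar>) - pi * (\<Sum>a\<leftarrow>A. \<bar>a\<bar>)"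
    by (intro tendsto_lowerbound) auto
  then show ?thesis by simp
qed

section \<open>Matching sums\<close>

text \<open>A matching is encoded as the involution exchanging the ends of its edges, so a matching with
  \<open>k\<close> edges contributes \<open>t ^ (2 * k)\<close> to the sum.\<close>

definition matching_perms :: "(nat \<Rightarrow> nat \<Rightarrow> bool) \<Rightarrow> nat set \<Rightarrow> (nat \<Rightarrow> nat) set" where
  "matching_perms E V = {p. p permutes V \<and> (\<forall>i. p (p i) = i) \<and> (\<forall>i. p i \<noteq> i \<longrightarrow> E i (p i))}"

definition matching_sum :: "(nat \<Rightarrow> nat \<Rightarrow> bool) \<Rightarrow> nat set \<Rightarrow> real \<Rightarrow> real" where
  "matching_sum E V t = (\<Sum>p\<in>matching_perms E V. \<Prod>i\<in>V. if p i = i then 1 else t)"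

lemma finite_matching_perms [simp]: "finite V \<Longrightarrow> finite (matching_perms E V)"
  unfolding matching_perms_def by (rule finite_subset[OF _ finite_permutations[of V]]) auto

lemma matching_sum_empty [simp]: "matching_sum E {} t = 1"
proof -
  have "matching_perms E {} = {id}" by (auto simp: matching_perms_def permutes_empty)
  then show ?thesis by (simp add: matching_sum_def)
qed

lemma matching_sum_singleton [simp]: "matching_sum E {v} t = 1"
proof -
  have "matching_perms E {v} = {id}" by (auto simp: matching_perms_def permutes_sing)
  then show ?thesis by (simp add: matching_sum_def)
qed

lemma matching_sum_cong:
  assumes "\<And>u v. u \<in> V \<Longrightarrow> v \<in> V \<Longrightarrow> E u v \<longleftrightarrow> E' u v"
  shows "matching_sum E V t = matching_sum E' V t"
proof -
  have "E i (p i) \<longleftrightarrow> E' i (p i)" if "p permutes V" "p i \<noteq> i" for p i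
  proof -
    have "i \<in> V" using that by (auto dest: permutes_not_in)
    then show ?thesis using assms permutes_in_image[OF that(1), of i] by simp
  qed
  then have "matching_perms E V = matching_perms E' V" by (auto simp: matching_perms_def)
  then show ?thesis by (simp add: matching_sum_def)
qed

lemma matching_perms_fixing:
  assumes "v \<in> V"
  shows "{p \<in> matching_perms E V. p v = v} = matching_perms E (V - {v})"
proof (intro equalityI subsetI)
  fix p assume "p \<in> {p \<in> matching_perms E V. p v = v}"
  then show "p \<in> matching_perms E (V - {v})"
    unfolding matching_perms_def by (auto intro: permutes_superset)
next
  fix p assume "p \<in> matching_perms E (V - {v})"
  then show "p \<in> {p \<in> matching_perms E V. p v = v}"
    unfolding matching_perms_def by (auto intro: permutes_subset dest: permutes_not_in)
qed

text \<open>Composing with the transposition of \<open>v\<close> and \<open>u\<close> deletes or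
  restores the edge between them and is its own inverse, so one map serves in both
  directions.\<close>

lemma matching_perms_moving:
  assumes sym: "symp E" and uv: "u \<in> V" "v \<in> V" "u \<noteq> v" "E v u"
  shows "bij_betw (\<lambda>q. transpose v u \<circ> q) (matching_perms E (V - {v, u})) {p \<in> matching_perms E V. p v = u}"
proof (rule bij_betwI[where g = "\<lambda>q. transpose v u \<circ> q"], goal_cases)
  case 1
  show ?case
  proof
    fix q assume q: "q \<in> matching_perms E (V - {v, u})"
    then have perm: "q permutes (V - {v, u})" and inv: "\<And>i. q (q i) = i"
      and edge: "\<And>i. q i \<noteq> i \<Longrightarrow> E i (q i)" by (auto simp: matching_perms_def)
    have fxd: "q v = v" "q u = u" using perm by (auto dest: permutes_not_in)
    have ne: "q i \<noteq> v" "q i \<noteq> u" if "i \<noteq> v" "i \<noteq> u" for i using inv fxd that by metis+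
    have "transpose v u \<circ> q permutes V"
      using uv by (intro permutes_compose permutes_subset[OF perm] permutes_swap_id) auto
    moreover have "(transpose v u \<circ> q) ((transpose v u \<circ> q) i) = i" for i
      using fxd ne[of i] inv[of i] by (cases "i = v"; cases "i = u") (auto simp: transpose_def)
    moreover have "E i ((transpose v u \<circ> q) i)" if "(transpose v u \<circ> q) i \<noteq> i" for i
      using that fxd ne[of i] edge[of i] uv sympD[OF sym] by (cases "i = v"; cases "i = u") (auto simp: transpose_def)
    ultimately show "transpose v u \<circ> q \<in> {p \<in> matching_perms E V. p v = u}"
      using fxd by (auto simp: matching_perms_def)
  qed
next
  case 2
  show ?case
  proof
    fix p assume p: "p \<in> {p \<in> matching_perms E V. p v = u}"
    then have perm: "p permutes V" and inv: "\<And>i. p (p i) = i" and pv: "p v = u"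
      and edge: "\<And>i. p i \<noteq> i \<Longrightarrow> E i (p i)" by (auto simp: matching_perms_def)
    have pu: "p u = v" using inv pv by metis
    have ne: "p i \<noteq> v" "p i \<noteq> u" if "i \<noteq> v" "i \<noteq> u" for i using inv pv pu that by metis+
    let ?q = "transpose v u \<circ> p"
    have fxd: "?q v = v" "?q u = u" using pv pu by auto
    have other: "?q i = p i" if "i \<noteq> v" "i \<noteq> u" for i using ne[OF that] by (auto simp: transpose_def)
    have "?q permutes V" using uv by (intro permutes_compose perm permutes_swap_id) auto
    then have "?q permutes (V - {v, u})" using fxd by (auto intro: permutes_superset)
    moreover have "?q (?q i) = i" for i
      using fxd other[of i] other[of "p i"] ne[of i] inv[of i] by (cases "i = v"; cases "i = u") auto
    moreover have "E i (?q i)" if "?q i \<noteq> i" for i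
      using that fxd other[of i] edge[of i] by (cases "i = v"; cases "i = u") auto
    ultimately show "?q \<in> matching_perms E (V - {v, u})" by (auto simp: matching_perms_def)
  qed
qed (auto simp: fun_eq_iff)

text \<open>Sort the matchings by the image of \<open>v\<close>: it is fixed, or it is matched with
  a neighbour \<open>u\<close>, and then the two moved points contribute \<open>t^2\<close>. The
  bounds and product formulas below all follow from this recursion.\<close>

lemma matching_sum_vertex:
  assumes fin: "finite V" and v: "v \<in> V"
    and sym: "symp E" and irr: "irreflp E"
  shows "matching_sum E V t = matching_sum E (V - {v}) t
           + t\<^sup>2 * (\<Sum>u\<in>{u\<in>V. E v u}. matching_sum E (V - {v, u}) t)"
proof -
  define w where "w = (\<lambda>(p :: nat \<Rightarrow> nat) (V :: nat set). \<Prod>i\<in>V. if p i = i then 1 else t)"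
  define N where "N = {u\<in>V. E v u}"
  define P where "P u = {p \<in> matching_perms E V. p v = u}" for u
  have N: "finite N" "v \<notin> N" using fin irreflpD[OF irr] by (auto simp: N_def)
  have split: "matching_perms E V = (\<Union>u\<in>insert v N. P u)"
  proof -
    have "p v = v \<or> p v \<in> N" if "p \<in> matching_perms E V" for p
      using that v permutes_in_image[of p V v] by (auto simp: matching_perms_def N_def)
    then show ?thesis by (auto simp: P_def)
  qed
  have "matching_sum E V t = (\<Sum>p\<in>(\<Union>u\<in>insert v N. P u). w p V)"
    unfolding matching_sum_def w_def split ..
  also have "\<dots> = (\<Sum>u\<in>insert v N. \<Sum>p\<in>P u. w p V)"
    using fin N by (intro sum.UNION_disjoint) (auto simp: P_def)
  also have "\<dots> = (\<Sum>p\<in>P v. w p V) + (\<Sum>u\<in>N. \<Sum>p\<in>P u. w p V)"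
    using N by simp
  also have "(\<Sum>p\<in>P v. w p V) = matching_sum E (V - {v}) t"
    unfolding P_def matching_perms_fixing[OF v] matching_sum_def
  proof (rule sum.cong[OF refl])
    fix p assume "p \<in> matching_perms E (V - {v})"
    then have "p v = v" by (auto simp: matching_perms_def dest: permutes_not_in)
    then show "w p V = (\<Prod>i\<in>V - {v}. if p i = i then 1 else t)"
      unfolding w_def by (subst prod.remove[OF fin v]) simp
  qed
  also have "(\<Sum>u\<in>N. \<Sum>p\<in>P u. w p V) = (\<Sum>u\<in>N. t\<^sup>2 * matching_sum E (V - {v, u}) t)"
  proof (rule sum.cong[OF refl])
    fix u assume "u \<in> N"
    then have u: "u \<in> V" "u \<noteq> v" "E v u" using N by (auto simp: N_def)
    have "(\<Sum>p\<in>P u. w p V) = (\<Sum>q\<in>matching_perms E (V - {v, u}). w (transpose v u \<circ> q) V)"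
      using sum.reindex_bij_betw[OF matching_perms_moving[OF sym u(1) v u(2,3)], of "\<lambda>p. w p V"]
      by (simp add: P_def)
    also have "\<dots> = (\<Sum>q\<in>matching_perms E (V - {v, u}). t\<^sup>2 * w q (V - {v, u}))"
    proof (rule sum.cong[OF refl])
      fix q assume q: "q \<in> matching_perms E (V - {v, u})"
      then have fxd: "q v = v" "q u = u" and inv: "\<And>i. q (q i) = i"
        by (auto simp: matching_perms_def dest: permutes_not_in)
      have ne: "q i \<noteq> v" "q i \<noteq> u" if "i \<noteq> v" "i \<noteq> u" for i using inv fxd that by metis+
      have V: "V = insert v (insert u (V - {v, u}))" using u v by auto
      have "w (transpose v u \<circ> q) V = t * (t * w (transpose v u \<circ> q) (V - {v, u}))"
        unfolding w_def using fxd u fin by (subst V, subst prod.insert, simp, simp, subst prod.insert) auto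
      also have "w (transpose v u \<circ> q) (V - {v, u}) = w q (V - {v, u})"
        unfolding w_def using ne by (intro prod.cong) (auto simp: transpose_def)
      finally show "w (transpose v u \<circ> q) V = t\<^sup>2 * w q (V - {v, u})"
        by (simp only: power2_eq_square mult.assoc)
    qed
    finally show "(\<Sum>p\<in>P u. w p V) = t\<^sup>2 * matching_sum E (V - {v, u}) t"
      by (simp add: matching_sum_def w_def sum_distrib_left)
  qed
  finally show ?thesis by (simp add: N_def sum_distrib_left)
qed

lemma matching_sum_ge_1:
  assumes "finite V" and sym: "symp E" and irr: "irreflp E"
  shows "matching_sum E V t \<ge> 1"
  using assms(1)
proof (induction V rule: finite_psubset_induct)
  case (psubset V)
  show ?case
  proof (cases "V = {}")
    case False
    then obtain v where v: "v \<in> V" by auto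
    have "matching_sum E (V - {v}) t \<ge> 1" using v psubset.IH[of "V - {v}"] by auto
    moreover have "(\<Sum>u\<in>{u\<in>V. E v u}. matching_sum E (V - {v, u}) t) \<ge> 0"
    proof (rule sum_nonneg)
      fix u
      have "matching_sum E (V - {v, u}) t \<ge> 1" using v psubset.IH[of "V - {v, u}"] by auto
      then show "matching_sum E (V - {v, u}) t \<ge> 0" by simp
    qed
    ultimately show ?thesis
      unfolding matching_sum_vertex[OF psubset.hyps v sym irr]
      by (smt (verit) mult_nonneg_nonneg zero_le_power2)
  qed simp
qed

lemma matching_sum_remove_le:
  assumes "finite V" "v \<in> V" and sym: "symp E" and irr: "irreflp E"
  shows "matching_sum E (V - {v}) t \<le> matching_sum E V t"
proof -
  have "0 \<le> matching_sum E (V - {v, u}) t" for u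
    using matching_sum_ge_1[of "V - {v, u}" E t, OF _ sym irr] assms(1) by auto
  then show ?thesis
    unfolding matching_sum_vertex[OF assms(1,2) sym irr] by (simp add: sum_nonneg)
qed

lemma matching_sum_disjoint_union:
  assumes "finite V" "finite W" "V \<inter> W = {}"
    and sym: "symp E" and irr: "irreflp E"
    and "\<And>v w. v \<in> V \<Longrightarrow> w \<in> W \<Longrightarrow> \<not> E v w"
  shows "matching_sum E (V \<union> W) t = matching_sum E V t * matching_sum E W t"
  using assms(1,3,6)
proof (induction V rule: finite_psubset_induct)
  case (psubset V)
  show ?case
  proof (cases "V = {}")
    case False
    then obtain v where v: "v \<in> V" by auto
    have IH: "matching_sum E (V - S \<union> W) t = matching_sum E (V - S) t * matching_sum E W t"
      if "v \<in> S" for S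
      using that v psubset.prems by (intro psubset.IH) auto
    have D: "(V \<union> W) - S = (V - S) \<union> W" if "S \<subseteq> V" for S using that psubset.prems by auto
    have N: "{u \<in> V \<union> W. E v u} = {u\<in>V. E v u}" using psubset.prems v by auto
    have "matching_sum E (V \<union> W) t = matching_sum E ((V \<union> W) - {v}) t
           + t\<^sup>2 * (\<Sum>u\<in>{u\<in>V. E v u}. matching_sum E ((V \<union> W) - {v, u}) t)"
      using matching_sum_vertex[of "V \<union> W" v E t, OF _ _ sym irr] psubset.hyps assms(2) v N by simp
    also have "\<dots> = matching_sum E (V - {v}) t * matching_sum E W t
           + t\<^sup>2 * (\<Sum>u\<in>{u\<in>V. E v u}. matching_sum E (V - {v, u}) t * matching_sum E W t)"
      using v by (simp add: D IH)
    also have "\<dots> = matching_sum E V t * matching_sum E W t"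
      unfolding matching_sum_vertex[OF psubset.hyps v sym irr, of t]
      by (simp add: sum_distrib_right algebra_simps flip: sum_distrib_left)
    finally show ?thesis .
  qed simp
qed

text \<open>A matching either avoids the bridge and splits into two, or uses it and leaves each side
  without its end of the bridge. The proof expands at \<open>r\<close>, whose only neighbour in
  \<open>W\<close> is \<open>c\<close>. This is the recursion that \<open>pjoin\<close>
  evaluates.\<close>

lemma matching_sum_bridge:
  assumes fin: "finite V" "finite W" and dis: "V \<inter> W = {}" and rc: "r \<in> V" "c \<in> W"
    and sym: "symp E" and irr: "irreflp E"
    and bridge: "\<And>v w. v \<in> V \<Longrightarrow> w \<in> W \<Longrightarrow> E v w \<longleftrightarrow> v = r \<and> w = c"
  shows "matching_sum E (V \<union> W) t = matching_sum E V t * matching_sum E W t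
           + t\<^sup>2 * (matching_sum E (V - {r}) t * matching_sum E (W - {c}) t)"
proof -
  let ?M = "\<lambda>V. matching_sum E V t"
  have N: "{u \<in> V \<union> W. E r u} = insert c {u\<in>V. E r u}" "c \<notin> {u\<in>V. E r u}"
    using bridge rc dis by auto
  have D: "V \<union> W - S = (V - S) \<union> W" if "S \<subseteq> V" for S using that dis by auto
  have c: "V \<union> W - {r, c} = (V - {r}) \<union> (W - {c})" using rc dis by auto
  have prod: "?M ((V - S) \<union> W) = ?M (V - S) * ?M W" if "r \<in> S" for S
    using that fin dis bridge by (intro matching_sum_disjoint_union sym irr) auto
  have "?M (V \<union> W) = ?M (V \<union> W - {r}) + t\<^sup>2 * (\<Sum>u\<in>{u\<in>V \<union> W. E r u}. ?M (V \<union> W - {r, u}))"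
    using fin rc by (intro matching_sum_vertex sym irr) auto
  also have "\<dots> = ?M (V - {r}) * ?M W + t\<^sup>2 * (?M ((V - {r}) \<union> (W - {c}))
      + (\<Sum>u\<in>{u\<in>V. E r u}. ?M (V - {r, u}) * ?M W))"
    unfolding N(1) using N(2) fin rc by (simp add: c D prod)
  also have "?M ((V - {r}) \<union> (W - {c})) = ?M (V - {r}) * ?M (W - {c})"
    using fin dis bridge by (intro matching_sum_disjoint_union sym irr) auto
  finally show ?thesis
    unfolding matching_sum_vertex[OF fin(1) rc(1) sym irr, of t]
    by (simp add: sum_distrib_right algebra_simps flip: sum_distrib_left)
qed

section \<open>The characteristic polynomial of an acyclic graph\<close>

lemma hermitian_eigenvalue_real:
  fixes A :: "complex mat"
  assumes A: "A \<in> carrier_mat n n"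
    and herm: "\<And>i j. i < n \<Longrightarrow> j < n \<Longrightarrow> A $$ (i, j) = cnj (A $$ (j, i))"
    and ev: "eigenvalue A a"
  shows "a \<in> \<real>"
proof -
  from ev obtain v where v: "v \<in> carrier_vec n" "v \<noteq> 0\<^sub>v n" "A *\<^sub>v v = a \<cdot>\<^sub>v v"
    using A unfolding eigenvalue_def eigenvector_def by auto
  have row: "(\<Sum>j<n. A $$ (i, j) * v $ j) = a * v $ i" if "i < n" for i
  proof -
    have "(A *\<^sub>v v) $ i = (\<Sum>j<n. A $$ (i, j) * v $ j)"
      using A v(1) that by (auto simp: scalar_prod_def lessThan_atLeast0 intro!: sum.cong)
    then show ?thesis using v(1) that unfolding v(3) by simp
  qed
  define N where "N = (\<Sum>i<n. v $ i * cnj (v $ i))"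
  \<comment> \<open>The Hermitian form of \<open>v\<close>: it equals its own conjugate, and also
    \<open>a\<close> times the squared norm \<open>N\<close>.\<close>
  define S where "S = (\<Sum>i<n. \<Sum>j<n. A $$ (i, j) * v $ j * cnj (v $ i))"
  have S: "S = a * N"
    unfolding S_def N_def sum_distrib_left
    by (intro sum.cong refl) (simp add: row flip: sum_distrib_right mult.assoc)
  have "cnj S = (\<Sum>i<n. \<Sum>j<n. A $$ (j, i) * cnj (v $ j) * v $ i)"
    unfolding S_def cnj_sum complex_cnj_mult
  proof (intro sum.cong refl)
    fix i j assume "i \<in> {..<n}" "j \<in> {..<n}"
    then have "A $$ (j, i) = cnj (A $$ (i, j))" by (intro herm) auto
    then show "cnj (A $$ (i, j)) * cnj (v $ j) * cnj (cnj (v $ i)) = A $$ (j, i) * cnj (v $ j) * v $ i" by simp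
  qed
  also have "\<dots> = S"
    unfolding S_def by (subst sum.swap) (simp add: mult_ac)
  finally have "cnj S = S" .
  moreover have N: "N = of_real (\<Sum>i<n. (cmod (v $ i))\<^sup>2)"
    unfolding N_def of_real_sum by (intro sum.cong refl) (simp only: complex_norm_square)
  ultimately have "cnj a * N = a * N" unfolding S by simp
  moreover have "N \<noteq> 0"
  proof
    assume "N = 0"
    then have "(\<Sum>i<n. (cmod (v $ i))\<^sup>2) = 0" unfolding N by (simp only: of_real_eq_0_iff)
    then have "\<forall>i\<in>{..<n}. (cmod (v $ i))\<^sup>2 = 0"
      by (subst (asm) sum_nonneg_eq_0_iff) auto
    then have "v = 0\<^sub>v n" using v(1) by (intro eq_vecI) auto
    with v(2) show False ..
  qed
  ultimately have "cnj a = a" by simp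
  then show ?thesis by (simp add: Reals_cnj_iff)
qed

text \<open>An orbit of length 3 or more would be a cycle of the graph, so only involutions survive
  in the Leibniz expansion of the determinant.\<close>

lemma permutes_along_acyclic_edges:
  assumes "finite V" and acyc: "\<nexists>vs. is_cycle E vs"
    and p: "p permutes V" and edge: "\<And>i. p i \<noteq> i \<Longrightarrow> E i (p i)"
  shows "p (p i) = i"
proof (rule ccontr)
  assume neq: "p (p i) \<noteq> i"
  have perm: "permutation p" using p assms(1) by (auto simp: permutation_permutes)
  define k where "k = least_power p i"
  have k: "(p ^^ k) i = i" "k > 0"
    unfolding k_def using least_power_of_permutation[OF perm] by auto
  have "k \<noteq> 1"
  proof
    assume "k = 1"
    then have "p i = i" using k by simp
    then show False using neq by simp
  qed
  moreover have "k \<noteq> 2"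
    using k(1) neq by (auto simp: numeral_2_eq_2)
  ultimately have k3: "k \<ge> 3" using k(2) by linarith
  have moved: "p ((p ^^ j) i) \<noteq> (p ^^ j) i" for j
  proof
    assume "p ((p ^^ j) i) = (p ^^ j) i"
    then have "(p ^^ j) (p i) = (p ^^ j) i" by (metis funpow_swap1)
    moreover have "inj (p ^^ j)"
      using permutes_inj[OF p] by (induction j) (auto intro: inj_compose)
    ultimately have "p i = i" by (simp add: inj_eq)
    then show False using neq by simp
  qed
  have step: "E ((p ^^ j) i) ((p ^^ Suc j) i)" for j using edge[OF moved[of j]] by simp
  let ?vs = "support p i"
  have "distinct ?vs" by (rule cycle_of_permutation[OF perm])
  moreover have "E (last ?vs) (hd ?vs)"
    using step[of "k - 1"] k k3 by (simp add: last_map hd_map flip: k_def)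
  ultimately have "is_cycle E ?vs"
    unfolding is_cycle_def using k3 step by (simp flip: k_def)
  with acyc show False by blast
qed

text \<open>Each transposition has sign -1 and brings the square of \<open>\<i>\<close>; the two
  minus signs cancel, so all matchings count positively.\<close>

lemma sign_times_prod_matching_perm:
  assumes "finite V" "p \<in> matching_perms E V" "symp E"
  shows "of_int (sign p) * (\<Prod>i\<in>V. if p i = i then 1 else \<i> * complex_of_real t)
       = of_real (\<Prod>i\<in>V. if p i = i then 1 else t)"
  using assms(1,2)
proof (induction V arbitrary: p rule: finite_psubset_induct)
  case (psubset V)
  show ?case
  proof (cases "\<exists>v. p v \<noteq> v")
    case False
    then have "p = id" by auto
    then show ?thesis by simp
  next
    case True
    then obtain v where v: "p v \<noteq> v" by auto
    have perm: "p permutes V" and inv: "\<And>i. p (p i) = i"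
      using psubset.prems by (auto simp: matching_perms_def)
    define u where "u = p v"
    have vu: "v \<in> V" "u \<in> V" "u \<noteq> v" "E v u"
      using v perm psubset.prems permutes_in_image[OF perm, of v]
      by (auto simp: u_def matching_perms_def dest: permutes_not_in)
    have bij: "bij_betw (\<lambda>q. transpose v u \<circ> q) (matching_perms E (V - {v, u})) {p \<in> matching_perms E V. p v = u}"
      using vu assms(3) by (intro matching_perms_moving)
    have "p \<in> {p \<in> matching_perms E V. p v = u}" using psubset.prems u_def by simp
    then obtain q where q: "q \<in> matching_perms E (V - {v, u})" "p = transpose v u \<circ> q"
      unfolding bij_betw_imp_surj_on[OF bij, symmetric] by (rule imageE)
    have qperm: "q permutes (V - {v, u})" using q by (simp add: matching_perms_def)
    have qf: "q v = v" "q u = u" using qperm by (auto dest: permutes_not_in)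
    have sgn: "sign p = - sign q"
    proof -
      have "permutation q" using qperm psubset.hyps by (auto simp: permutation_permutes)
      then show ?thesis using vu by (simp add: q(2) sign_compose sign_swap_id permutation_swap_id)
    qed
    have P: "(\<Prod>i\<in>V. if p i = i then 1 else x) = x * (x * (\<Prod>i\<in>V - {v, u}. if q i = i then 1 else x))"
      for x :: "'b :: comm_monoid_mult"
    proof -
      have "q i \<noteq> v" "q i \<noteq> u" if "i \<noteq> v" "i \<noteq> u" for i
        using q(1) qf that unfolding matching_perms_def by (metis (mono_tags, lifting) mem_Collect_eq)+
      then have *: "(\<Prod>i\<in>V - {v, u}. if p i = i then 1 else x) = (\<Prod>i\<in>V - {v, u}. if q i = i then 1 else x)"
        by (intro prod.cong) (auto simp: q(2) transpose_def)
      have V: "V = insert v (insert u (V - {v, u}))" using vu by auto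
      have "p u = v" using inv u_def by metis
      then show ?thesis
        using vu v psubset.hyps
        by (subst V, subst prod.insert, simp, simp, subst prod.insert) (auto simp: *[unfolded u_def] u_def)
    qed
    have IH: "of_int (sign q) * (\<Prod>i\<in>V - {v, u}. if q i = i then 1 else \<i> * complex_of_real t)
       = of_real (\<Prod>i\<in>V - {v, u}. if q i = i then 1 else t)"
      using psubset.IH[of "V - {v, u}" q] vu q by auto
    have "s * (\<i> * complex_of_real t * (\<i> * complex_of_real t * R)) = of_real t * (of_real t * (- s * R))" for s R
      by (simp add: algebra_simps)
    then have "of_int (sign p) * (\<Prod>i\<in>V. if p i = i then 1 else \<i> * complex_of_real t)
        = of_real t * (of_real t * (of_int (sign q) * (\<Prod>i\<in>V - {v, u}. if q i = i then 1 else \<i> * complex_of_real t)))"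
      unfolding P[of "\<i> * complex_of_real t"] sgn by (simp only: of_int_minus minus_minus)
    then show ?thesis
      unfolding IH P[of t] by (simp only: of_real_mult)
  qed
qed

text \<open>At \<open>x = \<i> / t\<close>, multiplying each row of \<open>x I - A\<close> by
  \<open>- \<i> t\<close> gives the matrix with 1 on the diagonal and \<open>\<i> t\<close> at the
  edges. By acyclicity its determinant is a sum over matchings.\<close>

lemma char_poly_on_imaginary_axis:
  assumes simp: "simple_graph n E" and acyc: "\<nexists>vs. is_cycle E vs" and t: "t \<noteq> 0"
  shows "(- \<i> * of_real t) ^ n * poly (char_poly (adjacency_matrix n E)) (\<i> / of_real t)
       = of_real (matching_sum E {0..<n} t)"
proof -
  let ?A = "adjacency_matrix n E" and ?x = "\<i> / complex_of_real t"
  let ?B = "- (char_matrix ?A ?x)"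
  have A: "?A \<in> carrier_mat n n" by (simp add: adjacency_matrix_def)
  have B: "?B \<in> carrier_mat n n" using A by simp
  have sym: "symp E" and irr: "\<And>v. \<not> E v v" using simp by (auto simp: simple_graph_def symp_def)
  have entry: "- \<i> * of_real t * ?B $$ (i, j) = (if i = j then 1 else if E i j then \<i> * of_real t else 0)"
    if "i < n" "j < n" for i j
    using that t irr[of j] by (auto simp: char_matrix_def adjacency_matrix_def)
  have "(- \<i> * of_real t) ^ n * det ?B
      = (\<Sum>p\<in>{p. p permutes {0..<n}}. of_int (sign p) *
          (\<Prod>i = 0..<n. if p i = i then 1 else if E i (p i) then \<i> * of_real t else 0))"
    unfolding det_def'[OF B] sum_distrib_left
  proof (rule sum.cong[OF refl])
    fix p assume "p \<in> {p. p permutes {0..<n}}"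
    then have p: "p permutes {0..<n}" by simp
    have "(- \<i> * of_real t) ^ n * (\<Prod>i = 0..<n. ?B $$ (i, p i))
        = (\<Prod>i = 0..<n. - \<i> * of_real t * ?B $$ (i, p i))"
      by (simp only: prod.distrib prod_constant card_atLeastLessThan diff_zero power_mult_distrib)
    also have "\<dots> = (\<Prod>i = 0..<n. if p i = i then 1 else if E i (p i) then \<i> * of_real t else 0)"
    proof (rule prod.cong[OF refl])
      fix i assume "i \<in> {0..<n}"
      then have "i < n" "p i < n" using permutes_in_image[OF p, of i] by auto
      then show "- \<i> * of_real t * ?B $$ (i, p i) = (if p i = i then 1 else if E i (p i) then \<i> * of_real t else 0)"
        using entry[of i "p i"] by auto
    qed
    finally have eq: "(- \<i> * of_real t) ^ n * (\<Prod>i = 0..<n. ?B $$ (i, p i))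
        = (\<Prod>i = 0..<n. if p i = i then 1 else if E i (p i) then \<i> * of_real t else 0)" .
    show "(- \<i> * of_real t) ^ n * (signof p * (\<Prod>i = 0..<n. ?B $$ (i, p i))) = of_int (sign p) *
          (\<Prod>i = 0..<n. if p i = i then 1 else if E i (p i) then \<i> * of_real t else 0)"
      by (simp only: mult.left_commute[of _ "signof p"] eq)
  qed
  also have "\<dots> = (\<Sum>p\<in>matching_perms E {0..<n}. of_int (sign p) *
          (\<Prod>i = 0..<n. if p i = i then 1 else if E i (p i) then \<i> * of_real t else 0))"
  proof (rule sum.mono_neutral_right)
    show "\<forall>p\<in>{p. p permutes {0..<n}} - matching_perms E {0..<n}. of_int (sign p) *
          (\<Prod>i = 0..<n. if p i = i then 1 else if E i (p i) then \<i> * of_real t else 0) = 0"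
    proof
      fix p assume p: "p \<in> {p. p permutes {0..<n}} - matching_perms E {0..<n}"
      then have "\<exists>i. p i \<noteq> i \<and> \<not> E i (p i)"
        using permutes_along_acyclic_edges[OF _ acyc, of "{0..<n}" p] by (auto simp: matching_perms_def)
      then obtain i where i: "p i \<noteq> i" "\<not> E i (p i)" by blast
      with p have "i \<in> {0..<n}" by (auto dest: permutes_not_in)
      with i have "(\<Prod>i = 0..<n. if p i = i then 1 else if E i (p i) then \<i> * complex_of_real t else 0) = 0"
        by (intro prod_zero) auto
      then show "of_int (sign p) *
          (\<Prod>i = 0..<n. if p i = i then 1 else if E i (p i) then \<i> * complex_of_real t else 0) = 0" by simp
    qed
  qed (auto simp: finite_permutations matching_perms_def)
  also have "\<dots> = (\<Sum>p\<in>matching_perms E {0..<n}. of_int (sign p) *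
          (\<Prod>i\<in>{0..<n}. if p i = i then 1 else \<i> * of_real t))"
    by (intro sum.cong refl arg_cong2[where f = "(*)"] prod.cong) (auto simp: matching_perms_def)
  also have "\<dots> = (\<Sum>p\<in>matching_perms E {0..<n}. of_real (\<Prod>i\<in>{0..<n}. if p i = i then 1 else t))"
    by (intro sum.cong refl sign_times_prod_matching_perm) (auto intro: sym)
  also have "\<dots> = of_real (matching_sum E {0..<n} t)"
    by (simp add: matching_sum_def)
  finally show ?thesis by (simp add: char_poly_matrix[OF A])
qed

text \<open>The matching sum is the product of the factors \<open>1 + \<i> t l\<close> over the
  eigenvalues \<open>l\<close>. As these are real, each factor has squared modulus
  \<open>1 + t^2 l^2\<close>; this is where the square on the right comes from.\<close>

lemma energy_acyclic:
  assumes simp: "simple_graph n E" and acyc: "\<nexists>vs. is_cycle E vs"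
  obtains ls :: "real list" where "energy n E = (\<Sum>l\<leftarrow>ls. \<bar>l\<bar>)"
    and "\<And>t. t \<noteq> 0 \<Longrightarrow> (\<Prod>l\<leftarrow>ls. 1 + t\<^sup>2 * l\<^sup>2) = (matching_sum E {0..<n} t)\<^sup>2"
proof -
  let ?A = "adjacency_matrix n E"
  have A: "?A \<in> carrier_mat n n" by (simp add: adjacency_matrix_def)
  obtain as where as: "char_poly ?A = (\<Prod>a\<leftarrow>as. [:- a, 1:])" "length as = n"
    using char_poly_factorized[OF A] by blast
  have real: "a \<in> \<real>" if "a \<in> set as" for a
  proof -
    have "poly (char_poly ?A) a = 0"
      using that unfolding as(1) by (induction as) auto
    then have "eigenvalue ?A a" using eigenvalue_root_char_poly[OF A] by simp
    then show ?thesis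
      using simp by (intro hermitian_eigenvalue_real[OF A]) (auto simp: adjacency_matrix_def simple_graph_def)
  qed
  have roots: "proots (\<Prod>a\<leftarrow>bs. [:- a, 1:]) = mset bs" for bs :: "complex list"
  proof (induction bs)
    case (Cons b bs)
    have "[:- a, 1:] \<noteq> 0" for a :: complex by simp
    then have "(\<Prod>a\<leftarrow>bs. [:- a, 1:]) \<noteq> 0" by (induction bs) (simp_all only: list.map prod_list.Cons prod_list.Nil mult_eq_0_iff, auto)
    then have "proots ([:- b, 1:] * (\<Prod>a\<leftarrow>bs. [:- a, 1:])) = {#b#} + mset bs"
      using Cons by (subst proots_mult) auto
    then show ?case by (simp only: list.map prod_list.Cons) simp
  qed simp
  define ls where "ls = map Re as"
  have "energy n E = sum_list (map cmod as)"
    unfolding energy_def as(1) roots by (simp flip: sum_mset_sum_list)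
  also have "\<dots> = (\<Sum>l\<leftarrow>ls. \<bar>l\<bar>)"
    unfolding ls_def map_map using real
    by (intro arg_cong[where f = sum_list] map_cong) (auto simp: complex_is_Real_iff cmod_eq_Re)
  finally have en: "energy n E = (\<Sum>l\<leftarrow>ls. \<bar>l\<bar>)" .
  have "(\<Prod>l\<leftarrow>ls. 1 + t\<^sup>2 * l\<^sup>2) = (matching_sum E {0..<n} t)\<^sup>2" if t: "t \<noteq> 0" for t
  proof -
    have factors: "(- \<i> * of_real t) ^ length bs * poly (\<Prod>a\<leftarrow>bs. [:- a, 1:]) (\<i> / of_real t)
        = (\<Prod>a\<leftarrow>bs. 1 + \<i> * of_real t * a)" for bs
      using t by (induction bs) (auto simp: field_simps)
    have "of_real (matching_sum E {0..<n} t) = (\<Prod>a\<leftarrow>as. 1 + \<i> * of_real t * a)"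
      using char_poly_on_imaginary_axis[OF assms t] factors[of as] unfolding as by simp
    then have "(matching_sum E {0..<n} t)\<^sup>2 = (cmod (\<Prod>a\<leftarrow>as. 1 + \<i> * of_real t * a))\<^sup>2"
      by (metis norm_of_real power2_abs)
    also have "\<dots> = (\<Prod>l\<leftarrow>ls. 1 + t\<^sup>2 * l\<^sup>2)"
      unfolding ls_def using real
    proof (induction as)
      case (Cons a as)
      have "a = of_real (Re a)" using Cons.prems by (simp add: complex_is_Real_iff complex_eq_iff)
      then have "(cmod (1 + \<i> * of_real t * a))\<^sup>2 = 1 + t\<^sup>2 * (Re a)\<^sup>2"
        by (subst cmod_power2) (simp add: complex_eq_iff power_mult_distrib)
      then show ?case using Cons by (simp add: norm_mult power_mult_distrib)
    qed simp
    finally show ?thesis ..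
  qed
  with en show ?thesis by (rule that)
qed

lemma energy_le_of_matching_sum_le:
  assumes "simple_graph n E" "\<nexists>vs. is_cycle E vs"
    and le: "\<And>t. t > 0 \<Longrightarrow> matching_sum E {0..<n} t \<le> (\<Prod>b\<leftarrow>bs. 1 + t\<^sup>2 * b\<^sup>2)"
  shows "energy n E \<le> 2 * (\<Sum>b\<leftarrow>bs. \<bar>b\<bar>)"
proof -
  obtain ls where ls: "energy n E = (\<Sum>l\<leftarrow>ls. \<bar>l\<bar>)"
    "\<And>t. t \<noteq> 0 \<Longrightarrow> (\<Prod>l\<leftarrow>ls. 1 + t\<^sup>2 * l\<^sup>2) = (matching_sum E {0..<n} t)\<^sup>2"
    using energy_acyclic[OF assms(1,2)] by blast
  \<comment> \<open>Squaring the bound takes each \<open>b\<close> twice, which is the factor 2 in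
    the conclusion.\<close>
  have "(\<Sum>l\<leftarrow>ls. \<bar>l\<bar>) \<le> (\<Sum>b\<leftarrow>bs @ bs. \<bar>b\<bar>)"
  proof (rule sum_abs_le_of_prod_le)
    fix y :: real assume y: "y > 0"
    define t where "t = sqrt y"
    have t: "t > 0" "y = t\<^sup>2" using y by (auto simp: t_def)
    have "1 \<le> matching_sum E {0..<n} t"
      using assms(1) by (intro matching_sum_ge_1) (auto simp: simple_graph_def symp_def irreflp_def)
    then have "(matching_sum E {0..<n} t)\<^sup>2 \<le> (\<Prod>b\<leftarrow>bs. 1 + t\<^sup>2 * b\<^sup>2)\<^sup>2"
      using le[OF t(1)] by (intro power_mono) auto
    then show "(\<Prod>l\<leftarrow>ls. 1 + y * l\<^sup>2) \<le> (\<Prod>b\<leftarrow>bs @ bs. 1 + y * b\<^sup>2)"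
      using ls(2)[of t] t by (simp add: power2_eq_square)
  qed
  then show ?thesis using ls by simp
qed

lemma energy_ge_of_matching_sum_ge:
  assumes "simple_graph n E" "\<nexists>vs. is_cycle E vs"
    and ge: "\<And>t. t > 0 \<Longrightarrow> (\<Prod>b\<leftarrow>bs. 1 + t\<^sup>2 * b\<^sup>2) \<le> matching_sum E {0..<n} t"
  shows "energy n E \<ge> 2 * (\<Sum>b\<leftarrow>bs. \<bar>b\<bar>)"
proof -
  obtain ls where ls: "energy n E = (\<Sum>l\<leftarrow>ls. \<bar>l\<bar>)"
    "\<And>t. t \<noteq> 0 \<Longrightarrow> (\<Prod>l\<leftarrow>ls. 1 + t\<^sup>2 * l\<^sup>2) = (matching_sum E {0..<n} t)\<^sup>2"
    using energy_acyclic[OF assms(1,2)] by blast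
  have "(\<Sum>b\<leftarrow>bs @ bs. \<bar>b\<bar>) \<le> (\<Sum>l\<leftarrow>ls. \<bar>l\<bar>)"
  proof (rule sum_abs_le_of_prod_le)
    fix y :: real assume y: "y > 0"
    define t where "t = sqrt y"
    have t: "t > 0" "y = t\<^sup>2" using y by (auto simp: t_def)
    have "0 \<le> (\<Prod>b\<leftarrow>bs. 1 + t\<^sup>2 * b\<^sup>2)" by (induction bs) auto
    then have "(\<Prod>b\<leftarrow>bs. 1 + t\<^sup>2 * b\<^sup>2)\<^sup>2 \<le> (matching_sum E {0..<n} t)\<^sup>2"
      using ge[OF t(1)] by (intro power_mono)
    then show "(\<Prod>b\<leftarrow>bs @ bs. 1 + y * b\<^sup>2) \<le> (\<Prod>l\<leftarrow>ls. 1 + y * l\<^sup>2)"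
      using ls(2)[of t] t by (simp add: power2_eq_square)
  qed
  then show ?thesis using ls by simp
qed

section \<open>Lower bounds by dynamic programming over rooted trees\<close>

fun padd :: "int list \<Rightarrow> int list \<Rightarrow> int list" where
  "padd [] q = q"
| "padd p [] = p"
| "padd (a # p) (b # q) = (a + b) # padd p q"

fun pmul :: "int list \<Rightarrow> int list \<Rightarrow> int list" where
  "pmul [] q = []"
| "pmul (a # p) q = padd (map ((*) a) q) (if p = [] then [] else 0 # pmul p q)"

text \<open>Nonnegative coefficients on the left are part of the test: products of lower bounds stay
  lower bounds because the factors are nonnegative.\<close>

fun ple :: "int list \<Rightarrow> int list \<Rightarrow> bool" where
  "ple [] q \<longleftrightarrow> list_all ((\<le>) 0) q"
| "ple (a # p) [] \<longleftrightarrow> False"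
| "ple (a # p) (b # q) \<longleftrightarrow> 0 \<le> a \<and> a \<le> b \<and> ple p q"

text \<open>The coefficients, in powers of \<open>t\<^sup>2\<close>, of lower bounds for the matching sums of a rooted tree and
  of that tree without its root. The operation \<open>pjoin\<close> below hangs its second argument below the
  root of the first.\<close>

type_synonym rp = "int list \<times> int list"

fun pjoin :: "rp \<Rightarrow> rp \<Rightarrow> rp" where
  "pjoin (a, a0) (b, b0) = (padd (pmul a b) (0 # pmul a0 b0), pmul a0 b)"

text \<open>Smaller coefficients give the weaker bound, so the dominating pair may replace the other
  for every tree that the other covers.\<close>

fun dominates :: "rp \<Rightarrow> rp \<Rightarrow> bool" where
  "dominates (a, a0) (b, b0) \<longleftrightarrow> ple a b \<and> ple a0 b0"

fun pinsert :: "rp \<Rightarrow> rp list \<Rightarrow> rp list" where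
  "pinsert x [] = [x]"
| "pinsert x (z # zs) = (if dominates z x then z # zs
     else if dominates x z then pinsert x zs else z # pinsert x zs)"

fun insert_joins :: "rp \<Rightarrow> rp list \<Rightarrow> rp list \<Rightarrow> rp list" where
  "insert_joins x [] acc = acc"
| "insert_joins x (z # zs) acc = insert_joins x zs (pinsert (pjoin x z) acc)"

fun all_joins :: "rp list \<Rightarrow> rp list \<Rightarrow> rp list \<Rightarrow> rp list" where
  "all_joins [] zs acc = acc"
| "all_joins (x # xs) zs acc = all_joins xs zs (insert_joins x zs acc)"

text \<open>The two tables list the branch sizes in opposite order, so that the sizes of the joined trees
  add up. A child has one neighbour outside its own branch, hence the last entry of its row.\<close>

fun front :: "rp list list list \<Rightarrow> rp list list list \<Rightarrow> nat \<Rightarrow> rp list \<Rightarrow> rp list" where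
  "front (R # Rs) (S # Ss) j acc = front Rs Ss j (all_joins (R ! j) (last S) acc)"
| "front _ _ j acc = acc"

text \<open>Entry 0 is empty because a root of degree 0 has no further vertices. Entry
  \<open>j + 1\<close> hangs one more branch below a tree whose root has degree at most
  \<open>j\<close>.\<close>

definition next_row :: "nat \<Rightarrow> rp list list list \<Rightarrow> rp list list" where
  "next_row D tab = [] # map (\<lambda>j. front tab (rev tab) j []) [0..<D - 1]"

text \<open>Entry \<open>table D k ! i ! j\<close> bounds the rooted trees with \<open>i + 1\<close> vertices, root degree at
  most \<open>j\<close> and all other degrees at most \<open>D\<close>.\<close>

fun table :: "nat \<Rightarrow> nat \<Rightarrow> rp list list list" where
  "table D 0 = []"
| "table D (Suc 0) = [replicate D [([1], [1])]]"
| "table D (Suc (Suc k)) = (let t = table D (Suc k) in t @ [next_row D t])"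

fun root_poly :: "int \<Rightarrow> int list \<Rightarrow> int list" where
  "root_poly q [] = [1]"
| "root_poly q (p # ps) = pmul [q * q, p * p] (root_poly q ps)"

text \<open>The numbers \<open>p / q\<close> with \<open>p\<close> from \<open>ps\<close> stand in for the positive eigenvalues; a factor
  \<open>q\<^sup>2\<close> for each of them keeps all coefficients integral.\<close>

fun energy_certificate :: "nat \<Rightarrow> rp list \<Rightarrow> int \<Rightarrow> int list \<Rightarrow> bool" where
  "energy_certificate n L q ps \<longleftrightarrow> 0 < q \<and> q * (int n - 1) \<le> 2 * sum_list ps \<and> list_all ((\<le>) 0) ps \<and>
     list_all (\<lambda>C. ple (root_poly q ps) (map ((*) (q ^ (2 * length ps))) (fst C))) L"

text \<open>In the whole tree the root may have degree \<open>D\<close>, one more than in any table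
  entry, so a last \<open>front\<close> at \<open>D - 1\<close> assembles it from the rows for at
  most \<open>n - 1\<close> vertices. One table serves all orders.\<close>

fun certificates :: "nat \<Rightarrow> rp list list list \<Rightarrow> (nat \<times> int \<times> int list) list \<Rightarrow> bool" where
  "certificates D T [] \<longleftrightarrow> True"
| "certificates D T ((n, q, ps) # xs) \<longleftrightarrow>
     energy_certificate n (front (take (n - 1) T) (rev (take (n - 1) T)) (D - 1) []) q ps \<and> certificates D T xs"

section \<open>Soundness of the pruned table\<close>

primrec peval :: "int list \<Rightarrow> real \<Rightarrow> real" where
  "peval [] y = 0"
| "peval (a # p) y = of_int a + y * peval p y"

lemma peval_padd [simp]: "peval (padd p q) y = peval p y + peval q y"
  by (induction p q rule: padd.induct) (auto simp: algebra_simps)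

lemma peval_map_times [simp]: "peval (map ((*) c) p) y = of_int c * peval p y"
  by (induction p) (auto simp: algebra_simps)

lemma peval_pmul [simp]: "peval (pmul p q) y = peval p y * peval q y"
  by (induction p q rule: pmul.induct) (auto simp: algebra_simps)

lemma peval_ple:
  assumes "y \<ge> 0" "ple p q"
  shows "0 \<le> peval p y \<and> peval p y \<le> peval q y"
  using assms(2)
proof (induction p q rule: ple.induct)
  case (1 q)
  then show ?case using assms(1) by (induction q) auto
next
  case (3 a p b q)
  then show ?case using assms(1) by (auto intro!: add_mono mult_left_mono)
qed simp

text \<open>Here \<open>y = t^2\<close>, while \<open>m\<close> and \<open>m0\<close> are the
  matching sums of a rooted tree with and without its root. As \<open>y\<close> is fixed, a tree may
  be covered by different pairs at different \<open>y\<close>.\<close>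

definition below :: "real \<Rightarrow> real \<Rightarrow> real \<Rightarrow> rp \<Rightarrow> bool" where
  "below y m m0 A \<longleftrightarrow> 0 \<le> peval (fst A) y \<and> peval (fst A) y \<le> m \<and> 0 \<le> peval (snd A) y \<and> peval (snd A) y \<le> m0"

definition covers :: "real \<Rightarrow> real \<Rightarrow> real \<Rightarrow> rp list \<Rightarrow> bool" where
  "covers y m m0 L \<longleftrightarrow> (\<exists>A\<in>set L. below y m m0 A)"

lemma below_dominates:
  assumes "y \<ge> 0" "dominates A B" "below y m m0 B"
  shows "below y m m0 A"
  using assms peval_ple[OF assms(1)]
  by (cases A; cases B) (fastforce simp: below_def)

lemma covers_pinsert: "y \<ge> 0 \<Longrightarrow> covers y m m0 (x # zs) \<Longrightarrow> covers y m m0 (pinsert x zs)"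
  by (induction x zs rule: pinsert.induct) (auto simp: covers_def intro: below_dominates)

lemma covers_insert_joins:
  assumes "y \<ge> 0"
  shows "covers y m m0 (map (pjoin x) zs @ acc) \<Longrightarrow> covers y m m0 (insert_joins x zs acc)"
proof (induction x zs acc rule: insert_joins.induct)
  case (2 x z zs acc)
  show ?case
    using "2.IH" covers_pinsert[OF assms, of m m0 "pjoin x z" acc] "2.prems" by (auto simp: covers_def)
qed simp

lemma covers_all_joins:
  assumes "y \<ge> 0"
  shows "covers y m m0 acc \<or> (\<exists>x\<in>set xs. \<exists>z\<in>set zs. below y m m0 (pjoin x z))
    \<Longrightarrow> covers y m m0 (all_joins xs zs acc)"
proof (induction xs zs acc rule: all_joins.induct)
  case (2 x xs zs acc)
  show ?case
    using "2.IH" covers_insert_joins[OF assms, of m m0 x zs acc] "2.prems" by (auto simp: covers_def)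
qed simp

lemma covers_front:
  assumes "y \<ge> 0"
  shows "covers y m m0 acc \<or> (\<exists>i<length Rs. i < length Ss \<and>
      (\<exists>x\<in>set (Rs ! i ! j). \<exists>z\<in>set (last (Ss ! i)). below y m m0 (pjoin x z)))
    \<Longrightarrow> covers y m m0 (front Rs Ss j acc)"
proof (induction Rs Ss j acc rule: front.induct)
  case (1 R Rs S Ss j acc)
  show ?case
  proof (simp, rule "1.IH")
    show "covers y m m0 (all_joins (R ! j) (last S) acc) \<or> (\<exists>i<length Rs. i < length Ss \<and>
      (\<exists>x\<in>set (Rs ! i ! j). \<exists>z\<in>set (last (Ss ! i)). below y m m0 (pjoin x z)))"
      using "1.prems"
    proof (elim disjE exE conjE)
      fix i assume i: "i < length (R # Rs)" "i < length (S # Ss)"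
        "\<exists>x\<in>set ((R # Rs) ! i ! j). \<exists>z\<in>set (last ((S # Ss) ! i)). below y m m0 (pjoin x z)"
      then show ?thesis
        by (cases i) (auto intro!: covers_all_joins assms)
    qed (auto intro: covers_all_joins assms)
  qed
qed auto

lemma below_pjoin:
  assumes "y \<ge> 0" "below y m m0 A" "below y m' m0' B"
  shows "below y (m * m' + y * (m0 * m0')) (m0 * m') (pjoin A B)"
  using assms by (cases A; cases B) (auto simp: below_def intro!: add_mono mult_mono mult_left_mono)

lemma length_table [simp]: "length (table D k) = k"
  by (induction D k rule: table.induct) (simp_all add: Let_def)

lemma length_table_row: "D \<ge> 1 \<Longrightarrow> i < k \<Longrightarrow> length (table D k ! i) = D"
  by (induction D k rule: table.induct) (auto simp: Let_def nth_append next_row_def less_Suc_eq)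

lemma take_table: "j \<le> k \<Longrightarrow> take j (table D k) = table D j"
proof (induction k)
  case (Suc k)
  show ?case
  proof (cases "j = Suc k")
    case False
    then have j: "j \<le> k" using Suc.prems by simp
    then show ?thesis using Suc.IH by (cases k) (auto simp: Let_def)
  qed simp
qed simp

lemma peval_root_poly:
  assumes "q > 0"
  shows "peval (root_poly q ps) y = of_int q ^ (2 * length ps) * (\<Prod>p\<leftarrow>ps. 1 + y * (of_int p / of_int q)\<^sup>2)"
proof (induction ps)
  case (Cons p ps)
  have "peval (root_poly q (p # ps)) y = (of_int q ^ 2 + y * of_int p ^ 2) * peval (root_poly q ps) y"
    by (simp add: power2_eq_square algebra_simps)
  also have "\<dots> = of_int q ^ 2 * (1 + y * (of_int p / of_int q)\<^sup>2) * peval (root_poly q ps) y"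
    using assms by (simp add: field_simps)
  finally show ?case unfolding Cons by (simp add: power2_eq_square mult_ac)
qed simp

text \<open>Degrees are counted inside \<open>V\<close>, so detaching a branch at the root lowers
  its bound by one. Acyclicity is assumed of the ambient \<open>E\<close>.\<close>

definition rooted_tree_on :: "nat \<Rightarrow> (nat \<Rightarrow> nat \<Rightarrow> bool) \<Rightarrow> nat set \<Rightarrow> nat \<Rightarrow> nat \<Rightarrow> bool" where
  "rooted_tree_on D E V r d \<longleftrightarrow> finite V \<and> r \<in> V \<and> (\<forall>v\<in>V. (\<lambda>a b. a \<in> V \<and> b \<in> V \<and> E a b)\<^sup>*\<^sup>* r v) \<and>
     card {u\<in>V. E r u} \<le> d \<and> (\<forall>v\<in>V - {r}. card {u\<in>V. E v u} \<le> D)"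

lemma distinct_path_of_rtranclp:
  assumes "R\<^sup>*\<^sup>* a b"
  shows "\<exists>vs. vs \<noteq> [] \<and> hd vs = a \<and> last vs = b \<and> distinct vs \<and>
    (\<forall>i. Suc i < length vs \<longrightarrow> R (vs ! i) (vs ! Suc i))"
  using assms
proof (induction rule: rtranclp_induct)
  case base
  show ?case by (intro exI[of _ "[a]"]) simp
next
  case (step b c)
  then obtain vs where vs: "vs \<noteq> []" "hd vs = a" "last vs = b" "distinct vs"
    "\<And>i. Suc i < length vs \<Longrightarrow> R (vs ! i) (vs ! Suc i)" by blast
  show ?case
  proof (cases "c \<in> set vs")
    case True
    then obtain i where i: "i < length vs" "vs ! i = c" by (auto simp: in_set_conv_nth)
    let ?ws = "take (Suc i) vs"
    have "last ?ws = c" using i by (simp add: take_Suc_conv_app_nth)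
    moreover have "hd ?ws = a" using vs by (simp add: hd_take)
    ultimately show ?thesis using vs by (intro exI[of _ ?ws]) auto
  next
    case False
    have "R ((vs @ [c]) ! i) ((vs @ [c]) ! Suc i)" if "Suc i < length (vs @ [c])" for i
    proof (cases "Suc i < length vs")
      case True
      then show ?thesis using vs(5) by (simp add: nth_append)
    next
      case False
      then have "i = length vs - 1" "i < length vs" "Suc i = length vs" using that vs(1) by auto
      then show ?thesis using vs(1,3) step(2) by (auto simp: nth_append last_conv_nth)
    qed
    then show ?thesis using vs False by (intro exI[of _ "vs @ [c]"]) auto
  qed
qed

text \<open>Take a neighbour \<open>c\<close> of \<open>r\<close> and let \<open>V2\<close> collect
  what \<open>c\<close> reaches while avoiding \<open>r\<close>. An edge that enters
  \<open>V2\<close> from outside must start at \<open>r\<close>; if it ended at some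
  \<open>w\<close> other than \<open>c\<close>, the path from \<open>c\<close> to \<open>w\<close>
  inside \<open>V2\<close> would close to a cycle through \<open>r\<close>.\<close>

lemma rooted_tree_on_split:
  assumes sym: "symp E" and irr: "irreflp E" and acyc: "\<nexists>vs. is_cycle E vs"
    and tree: "rooted_tree_on D E V r d" and "V \<noteq> {r}"
  obtains c V1 V2 where "V = V1 \<union> V2" "V1 \<inter> V2 = {}" "r \<in> V1" "c \<in> V2" "d \<ge> 1"
    "\<And>v w. v \<in> V1 \<Longrightarrow> w \<in> V2 \<Longrightarrow> E v w \<longleftrightarrow> v = r \<and> w = c"
    "rooted_tree_on D E V1 r (d - 1)" "rooted_tree_on D E V2 c (D - 1)"
proof -
  have fin: "finite V" and r: "r \<in> V" and degr: "card {u\<in>V. E r u} \<le> d"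
    and deg: "\<And>v. v \<in> V \<Longrightarrow> v \<noteq> r \<Longrightarrow> card {u\<in>V. E v u} \<le> D"
    and reach: "\<And>v. v \<in> V \<Longrightarrow> (\<lambda>a b. a \<in> V \<and> b \<in> V \<and> E a b)\<^sup>*\<^sup>* r v"
    using tree unfolding rooted_tree_on_def by auto
  obtain x where "x \<in> V" "x \<noteq> r" using r \<open>V \<noteq> {r}\<close> by auto
  with reach[of x] obtain c where c: "c \<in> V" "E r c" by (auto elim: converse_rtranclpE)
  then have cr: "c \<noteq> r" using irreflpD[OF irr] by auto
  define R where "R a b \<longleftrightarrow> a \<in> V - {r} \<and> b \<in> V - {r} \<and> E a b" for a b
  define V2 where "V2 = {v\<in>V - {r}. R\<^sup>*\<^sup>* c v}"
  define V1 where "V1 = V - V2"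
  have V: "V = V1 \<union> V2" "V1 \<inter> V2 = {}" "r \<in> V1" "c \<in> V2"
    using r c cr by (auto simp: V1_def V2_def)
  have only: "v = r \<and> w = c" if vw: "v \<in> V1" "w \<in> V2" "E v w" for v w
  proof -
    have wc: "R\<^sup>*\<^sup>* c w" "w \<in> V - {r}" using vw by (auto simp: V2_def)
    have vr: "v = r"
    proof (rule ccontr)
      assume "v \<noteq> r"
      then have "R w v" using vw sympD[OF sym] by (auto simp: R_def V1_def V2_def)
      with wc(1) have "R\<^sup>*\<^sup>* c v" by (rule rtranclp.rtrancl_into_rtrancl)
      then have "v \<in> V2" using \<open>v \<noteq> r\<close> vw(1) by (auto simp: V2_def V1_def)
      then show False using vw(1) by (simp add: V1_def)
    qed
    moreover have "w = c"
    proof (rule ccontr)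
      assume "w \<noteq> c"
      obtain vs where vs: "vs \<noteq> []" "hd vs = c" "last vs = w" "distinct vs"
        "\<And>i. Suc i < length vs \<Longrightarrow> R (vs ! i) (vs ! Suc i)"
        using distinct_path_of_rtranclp[OF wc(1)] by blast
      have len: "length vs \<ge> 2"
        using vs \<open>w \<noteq> c\<close> by (cases vs; cases "tl vs") auto
      have "r \<notin> set vs"
      proof
        assume "r \<in> set vs"
        then obtain i where i: "i < length vs" "vs ! i = r" by (auto simp: in_set_conv_nth)
        show False
        proof (cases "Suc i < length vs")
          case True
          then show False using vs(5)[OF True] i by (simp add: R_def)
        next
          case False
          then have "i = length vs - 1" using i by simp
          then show False using i vs(1,3) wc(2) by (simp add: last_conv_nth)
        qed
      qed
      moreover have "E ((r # vs) ! i) ((r # vs) ! Suc i)" if "Suc i < length (r # vs)" for i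
        using that vs c by (cases i) (auto simp: R_def hd_conv_nth)
      moreover have "E (last (r # vs)) (hd (r # vs))"
        using vs vw vr sympD[OF sym] by auto
      ultimately have "is_cycle E (r # vs)" using vs len by (auto simp: is_cycle_def)
      then show False using acyc by blast
    qed
    ultimately show ?thesis by simp
  qed
  have d1: "d \<ge> 1"
  proof -
    have "card {u\<in>V. E r u} > 0" using fin c by (subst card_gt_0_iff) auto
    then show ?thesis using degr by simp
  qed
  have fins: "finite V1" "finite V2" using fin V by auto
  have mono: "card {u\<in>V'. E v u} \<le> card {u\<in>V. E v u}" if "V' \<subseteq> V" for V' v
    using that fin by (intro card_mono) auto
  have reach1: "(\<lambda>a b. a \<in> V1 \<and> b \<in> V1 \<and> E a b)\<^sup>*\<^sup>* r v" if "v \<in> V1" for v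
  proof -
    have "v \<in> V" using that V by auto
    from reach[OF this] have "v \<in> V2 \<or> (\<lambda>a b. a \<in> V1 \<and> b \<in> V1 \<and> E a b)\<^sup>*\<^sup>* r v"
    proof (induction rule: rtranclp_induct)
      case (step v w)
      show ?case
      proof (cases "w \<in> V2")
        case False
        then have w1: "w \<in> V1" using step V by auto
        show ?thesis
        proof (cases "v \<in> V2")
          case True
          then have "w = r" using only[OF w1 True] step sympD[OF sym] by auto
          then show ?thesis by simp
        next
          case False
          then have "v \<in> V1" using step V by auto
          moreover have "(\<lambda>a b. a \<in> V1 \<and> b \<in> V1 \<and> E a b)\<^sup>*\<^sup>* r v" using step False by auto
          ultimately show ?thesis using w1 step(2) by (auto intro: rtranclp.rtrancl_into_rtrancl)
        qed
      qed simp
    qed simp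
    then show ?thesis using that V by auto
  qed
  have reach2: "(\<lambda>a b. a \<in> V2 \<and> b \<in> V2 \<and> E a b)\<^sup>*\<^sup>* c v" if "v \<in> V2" for v
  proof -
    have "R\<^sup>*\<^sup>* c v" using that by (simp add: V2_def)
    then have "v \<in> V2 \<and> (\<lambda>a b. a \<in> V2 \<and> b \<in> V2 \<and> E a b)\<^sup>*\<^sup>* c v"
    proof (induction rule: rtranclp_induct)
      case (step v w)
      from step(1,2) have "R\<^sup>*\<^sup>* c w" by (rule rtranclp.rtrancl_into_rtrancl)
      then have "w \<in> V2" using step(2) by (auto simp: V2_def R_def)
      then show ?case using step by (auto simp: R_def intro: rtranclp.rtrancl_into_rtrancl)
    qed (use V in auto)
    then show ?thesis by simp
  qed
  have "rooted_tree_on D E V1 r (d - 1)"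
    unfolding rooted_tree_on_def
  proof (intro conjI ballI)
    have "{u\<in>V. E r u} = insert c {u\<in>V1. E r u}" "c \<notin> V1"
      using only[OF V(3)] V c by blast+
    then have "card {u\<in>V. E r u} = Suc (card {u\<in>V1. E r u})" using fins by simp
    then show "card {u\<in>V1. E r u} \<le> d - 1" using degr by simp
    show "card {u\<in>V1. E v u} \<le> D" if "v \<in> V1 - {r}" for v
      using that V mono[of V1 v] deg[of v] by force
  qed (use fins V reach1 in auto)
  moreover have "rooted_tree_on D E V2 c (D - 1)"
    unfolding rooted_tree_on_def
  proof (intro conjI ballI)
    \<comment> \<open>Within its own branch \<open>c\<close> loses the edge to \<open>r\<close>,
      hence the bound \<open>D - 1\<close>.\<close>
    have "insert r {u\<in>V2. E c u} \<subseteq> {u\<in>V. E c u}" "r \<notin> V2"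
      using V c sympD[OF sym c(2)] r by blast+
    then have "Suc (card {u\<in>V2. E c u}) \<le> card {u\<in>V. E c u}"
      using fin fins card_mono[of "{u\<in>V. E c u}" "insert r {u\<in>V2. E c u}"] by simp
    also have "\<dots> \<le> D" using deg c cr by auto
    finally show "card {u\<in>V2. E c u} \<le> D - 1" by simp
    show "card {u\<in>V2. E v u} \<le> D" if "v \<in> V2 - {c}" for v
      using that V mono[of V2 v] deg[of v] by force
  qed (use fins V reach2 in auto)
  moreover have "E v w \<longleftrightarrow> v = r \<and> w = c" if "v \<in> V1" "w \<in> V2" for v w
    using only[OF that] c by auto
  ultimately show ?thesis using that V d1 by blast
qed

text \<open>The two claims depend on each other: row \<open>k\<close>, for trees with
  \<open>Suc k\<close> vertices, is built by \<open>front\<close> from the first \<open>k\<close>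
  rows, and \<open>front\<close> joins two trees already covered by rows. Hence one induction on
  \<open>k\<close> for both.\<close>

lemma covers_table_and_front:
  assumes D: "D \<ge> 1" and sym: "symp E" and irr: "irreflp E" and acyc: "\<nexists>vs. is_cycle E vs"
  shows "i < k \<Longrightarrow> j < D \<Longrightarrow> rooted_tree_on D E V r j \<Longrightarrow> card V = Suc i
      \<Longrightarrow> covers (t\<^sup>2) (matching_sum E V t) (matching_sum E (V - {r}) t) (table D k ! i ! j)"
    and "k \<ge> 1 \<Longrightarrow> j < D \<Longrightarrow> rooted_tree_on D E V r (Suc j) \<Longrightarrow> card V = Suc k
      \<Longrightarrow> covers (t\<^sup>2) (matching_sum E V t) (matching_sum E (V - {r}) t) (front (table D k) (rev (table D k)) j [])"
proof (induction k arbitrary: i j V r)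
  case (Suc k)
  let ?cov = "\<lambda>V r. covers (t\<^sup>2) (matching_sum E V t) (matching_sum E (V - {r}) t)"
  have row: "?cov V r (table D (Suc k) ! i ! j)"
    if i: "i < Suc k" and j: "j < D" and tree: "rooted_tree_on D E V r j" and card: "card V = Suc i" for i j V r
  proof (cases "i < k")
    case True
    then have "table D (Suc k) ! i = table D k ! i" by (cases k) (auto simp: Let_def nth_append)
    then show ?thesis using Suc.IH(1)[OF True j tree card] by simp
  next
    case False
    then have ik: "i = k" using i by simp
    show ?thesis
    proof (cases k)
      case 0
      then have V: "V = {r}"
        using card ik tree by (auto simp: rooted_tree_on_def card_1_singleton_iff)
      show ?thesis using 0 ik j V by (simp add: covers_def below_def)
    next
      case (Suc l)
      have "j \<noteq> 0"
      proof
        assume "j = 0"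
        have "V \<noteq> {r}" using card ik Suc by auto
        from rooted_tree_on_split[OF sym irr acyc tree this] \<open>j = 0\<close> show False by (metis not_one_le_zero)
      qed
      then obtain j' where j': "j = Suc j'" by (cases j) auto
      have "[0..<D - Suc 0] ! j' = j'" using j j' by (subst nth_upt) auto
      then have "table D (Suc k) ! i ! j = front (table D k) (rev (table D k)) j' []"
        using Suc ik j j' by (simp add: Let_def nth_append next_row_def del: table.simps(2))
      then show ?thesis using Suc.IH(2)[of j' V r] j j' tree card ik Suc by simp
    qed
  qed
  {
    case 1
    then show ?case using row by blast
  next
    case 2
    have "V \<noteq> {r}" using 2 by auto
    then obtain c V1 V2 where s: "V = V1 \<union> V2" "V1 \<inter> V2 = {}" "r \<in> V1" "c \<in> V2"
      "\<And>v w. v \<in> V1 \<Longrightarrow> w \<in> V2 \<Longrightarrow> E v w \<longleftrightarrow> v = r \<and> w = c"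
      "rooted_tree_on D E V1 r j" "rooted_tree_on D E V2 c (D - 1)"
      by (rule rooted_tree_on_split[OF sym irr acyc 2(3), unfolded diff_Suc_1]) (rule that; blast)
    have fin: "finite V1" "finite V2" using s by (auto simp: rooted_tree_on_def)
    obtain a where a: "card V1 = Suc a" using fin s by (cases "card V1") auto
    obtain b where b: "card V2 = Suc b" using fin s by (cases "card V2") auto
    \<comment> \<open>The two parts have \<open>a + 1\<close> and \<open>b + 1\<close> of the
      \<open>k + 2\<close> vertices.\<close>
    have ab: "a + b = k" using 2 a b s fin by (simp add: card_Un_disjoint)
    have M: "matching_sum E V t = matching_sum E V1 t * matching_sum E V2 t
        + t\<^sup>2 * (matching_sum E (V1 - {r}) t * matching_sum E (V2 - {c}) t)"
      unfolding s(1) using fin s sym irr by (intro matching_sum_bridge) auto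
    have "V - {r} = (V1 - {r}) \<union> V2" using s by auto
    then have M0: "matching_sum E (V - {r}) t = matching_sum E (V1 - {r}) t * matching_sum E V2 t"
      using fin s sym irr by (auto intro!: matching_sum_disjoint_union)
    obtain x where x: "x \<in> set (table D (Suc k) ! a ! j)" "below (t\<^sup>2) (matching_sum E V1 t) (matching_sum E (V1 - {r}) t) x"
      using row[of a j V1 r] ab 2 s a by (auto simp: covers_def)
    obtain z where z: "z \<in> set (table D (Suc k) ! b ! (D - 1))" "below (t\<^sup>2) (matching_sum E V2 t) (matching_sum E (V2 - {c}) t) z"
      using row[of b "D - 1" V2 c] ab D s b by (auto simp: covers_def)
    have "rev (table D (Suc k)) ! a = table D (Suc k) ! b"
      using ab by (subst rev_nth) (auto simp del: table.simps)
    then have "z \<in> set (last (rev (table D (Suc k)) ! a))"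
      using z(1) last_conv_nth[of "table D (Suc k) ! b"] length_table_row[OF D, of b "Suc k"] ab D
      by (cases "table D (Suc k) ! b = []") (auto simp del: table.simps)
    then show ?case
      using x z below_pjoin[OF _ x(2) z(2)] ab unfolding M M0
      by (intro covers_front disjI2 exI[of _ a]) (auto simp del: table.simps)
  }
qed simp_all

lemma energy_lower_bound:
  assumes tree: "is_tree n E" and deg: "max_degree n E \<le> D" and "D \<ge> 1" "n \<ge> 2"
    and cert: "energy_certificate n (front (table D (n - 1)) (rev (table D (n - 1))) (D - 1) []) q ps"
  shows "energy n E \<ge> real n - 1"
proof -
  have simp: "simple_graph n E" and conn: "connected_graph n E" and acyc: "\<nexists>vs. is_cycle E vs"
    using tree by (auto simp: is_tree_def)
  have sym: "symp E" and irr: "irreflp E" and range: "\<And>u v. E u v \<Longrightarrow> u < n \<and> v < n"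
    using simp by (auto simp: simple_graph_def symp_def irreflp_def)
  have degree: "card {u\<in>{0..<n}. E v u} \<le> D" if "v < n" for v
  proof -
    have "degree n E v \<le> max_degree n E"
      unfolding max_degree_def using that by (intro Max_ge) auto
    then show ?thesis using deg by (simp add: degree_def)
  qed
  have "(\<lambda>a b. a \<in> {0..<n} \<and> b \<in> {0..<n} \<and> E a b) = E" using range by (auto simp: fun_eq_iff)
  then have rooted: "rooted_tree_on D E {0..<n} 0 (Suc (D - 1))"
    using degree conn \<open>D \<ge> 1\<close> \<open>n \<ge> 2\<close> by (auto simp: rooted_tree_on_def connected_graph_def)
  define L where "L = front (table D (n - 1)) (rev (table D (n - 1))) (D - 1) []"
  from cert have q: "q > 0" and qs: "q * (int n - 1) \<le> 2 * sum_list ps" and ps: "\<forall>p\<in>set ps. 0 \<le> p"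
    and L: "\<And>C. C \<in> set L \<Longrightarrow> ple (root_poly q ps) (map ((*) (q ^ (2 * length ps))) (fst C))"
    by (auto simp: L_def list_all_iff)
  define bs where "bs = map (\<lambda>p. real_of_int p / real_of_int q) ps"
  have "2 * (\<Sum>b\<leftarrow>bs. \<bar>b\<bar>) \<le> energy n E"
  proof (rule energy_ge_of_matching_sum_ge[OF simp acyc])
    fix t :: real
    \<comment> \<open>The covering pair depends on \<open>t\<close>, but the certificate puts the
      same product below every pair in \<open>L\<close>.\<close>
    have "covers (t\<^sup>2) (matching_sum E {0..<n} t) (matching_sum E ({0..<n} - {0}) t) L"
      unfolding L_def using \<open>D \<ge> 1\<close> \<open>n \<ge> 2\<close> rooted
      by (intro covers_table_and_front(2) sym irr acyc) auto
    then obtain C where C: "C \<in> set L" "peval (fst C) (t\<^sup>2) \<le> matching_sum E {0..<n} t"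
      by (auto simp: covers_def below_def)
    have "of_int q ^ (2 * length ps) * (\<Prod>b\<leftarrow>bs. 1 + t\<^sup>2 * b\<^sup>2) \<le> of_int q ^ (2 * length ps) * peval (fst C) (t\<^sup>2)"
      using peval_ple[OF _ L[OF C(1)], of "t\<^sup>2"] by (simp add: peval_root_poly[OF q] bs_def o_def)
    then have "(\<Prod>b\<leftarrow>bs. 1 + t\<^sup>2 * b\<^sup>2) \<le> peval (fst C) (t\<^sup>2)" using q by simp
    then show "(\<Prod>b\<leftarrow>bs. 1 + t\<^sup>2 * b\<^sup>2) \<le> matching_sum E {0..<n} t" using C(2) by simp
  qed
  moreover have "real n - 1 \<le> 2 * (\<Sum>b\<leftarrow>bs. \<bar>b\<bar>)"
  proof -
    have "(\<Sum>b\<leftarrow>bs. \<bar>b\<bar>) = of_int (sum_list ps) / of_int q"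
      unfolding bs_def using ps q by (induction ps) (auto simp: add_divide_distrib)
    moreover have "of_int q * (real n - 1) \<le> 2 * of_int (sum_list ps)"
      using qs by (metis (mono_tags, lifting) of_int_le_iff of_int_mult of_int_diff of_int_1 of_int_of_nat_eq of_int_numeral)
    ultimately have "of_int q * (real n - 1) \<le> of_int q * (2 * (\<Sum>b\<leftarrow>bs. \<bar>b\<bar>))"
      using q by simp
    then show ?thesis using q by (simp only: mult_le_cancel_left_pos of_int_0_less_iff)
  qed
  ultimately show ?thesis by simp
qed

lemma certificates_sound:
  assumes "certificates D (table D N) xs" "(n, q, ps) \<in> set xs" "n \<le> Suc N"
  shows "energy_certificate n (front (table D (n - 1)) (rev (table D (n - 1))) (D - 1) []) q ps"
proof -
  have "take (n - 1) (table D N) = table D (n - 1)" using assms(3) by (intro take_table) simp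
  then show ?thesis
    using assms(1,2) by (induction xs) (auto simp del: energy_certificate.simps)
qed

section \<open>Building trees from stars\<close>

definition par_edges :: "nat \<Rightarrow> nat \<Rightarrow> (nat \<Rightarrow> nat) \<Rightarrow> nat \<Rightarrow> nat \<Rightarrow> bool" where
  "par_edges a n par u v \<longleftrightarrow> (u \<in> {a<..<a+n} \<and> v = par u) \<or> (v \<in> {a<..<a+n} \<and> u = par v)"

definition is_par :: "nat \<Rightarrow> nat \<Rightarrow> (nat \<Rightarrow> nat) \<Rightarrow> bool" where
  "is_par a n par \<longleftrightarrow> n \<ge> 1 \<and> (\<forall>u\<in>{a<..<a+n}. a \<le> par u \<and> par u < u)"

lemma par_edges_cases:
  assumes "is_par a n par" "par_edges a n par u v"
  shows "(v = par u \<and> a \<le> v \<and> v < u \<and> u < a + n) \<or> (u = par v \<and> a \<le> u \<and> u < v \<and> v < a + n)"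
  using assms by (auto simp: is_par_def par_edges_def)

lemma par_edges_range: "is_par a n par \<Longrightarrow> par_edges a n par u v \<Longrightarrow> u \<in> {a..<a+n} \<and> v \<in> {a..<a+n}"
  using par_edges_cases[of a n par u v] by auto

lemma symp_par_edges: "symp (par_edges a n par)"
  by (auto simp: symp_def par_edges_def)

lemma irreflp_par_edges: "is_par a n par \<Longrightarrow> irreflp (par_edges a n par)"
  using par_edges_cases[of a n par] by (auto simp: irreflp_def)

text \<open>The largest vertex of a cycle would have two distinct smaller neighbours on it, but its
  only smaller neighbour is its parent.\<close>

lemma par_edges_acyclic:
  assumes "is_par a n par"
  shows "\<nexists>vs. is_cycle (par_edges a n par) vs"
proof
  assume "\<exists>vs. is_cycle (par_edges a n par) vs"
  then obtain vs where len: "length vs \<ge> 3" and dist: "distinct vs"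
    and step: "\<And>i. Suc i < length vs \<Longrightarrow> par_edges a n par (vs ! i) (vs ! Suc i)"
    and close: "par_edges a n par (last vs) (hd vs)"
    by (auto simp: is_cycle_def)
  define k where "k = length vs"
  have vs: "vs \<noteq> []" using len by auto
  have close': "par_edges a n par (vs ! (k - 1)) (vs ! 0)"
    using close vs by (simp add: last_conv_nth hd_conv_nth k_def)
  define m where "m = Max (set vs)"
  have "m \<in> set vs" unfolding m_def using vs by (intro Max_in) auto
  then obtain i where i: "i < k" "vs ! i = m" by (auto simp: in_set_conv_nth k_def)
  have parent: "vs ! j = par m"
    if "j < k" "par_edges a n par (vs ! i) (vs ! j) \<or> par_edges a n par (vs ! j) (vs ! i)" for j
  proof -
    have "vs ! j \<le> m" unfolding m_def using that by (intro Max_ge) (auto simp: k_def)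
    then show ?thesis
      using that(2) i par_edges_cases[OF assms, of "vs ! i" "vs ! j"] par_edges_cases[OF assms, of "vs ! j" "vs ! i"]
      by auto
  qed
  define nx where "nx = (if Suc i < k then Suc i else 0)"
  define pv where "pv = (if i = 0 then k - 1 else i - 1)"
  have lt: "nx < k" "pv < k" using i len by (auto simp: nx_def pv_def k_def)
  have "nx \<noteq> pv" using i len by (auto simp: nx_def pv_def k_def split: if_splits)
  moreover have "vs ! nx = par m"
  proof (rule parent[OF lt(1)])
    show "par_edges a n par (vs ! i) (vs ! nx) \<or> par_edges a n par (vs ! nx) (vs ! i)"
    proof (cases "Suc i < k")
      case False
      then have "i = k - 1" using i by simp
      then show ?thesis using close' False by (simp add: nx_def)
    qed (use step in \<open>simp add: nx_def k_def\<close>)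
  qed
  moreover have "vs ! pv = par m"
  proof (rule parent[OF lt(2)])
    show "par_edges a n par (vs ! i) (vs ! pv) \<or> par_edges a n par (vs ! pv) (vs ! i)"
      using close' step[of "i - 1"] i by (auto simp: pv_def k_def)
  qed
  ultimately show False using nth_eq_iff_index_eq[OF dist, of nx pv] lt by (simp add: k_def)
qed

lemma is_tree_par_edges:
  assumes "is_par 0 n par"
  shows "is_tree n (par_edges 0 n par)"
proof -
  let ?E = "par_edges 0 n par"
  have "simple_graph n ?E"
    using par_edges_range[OF assms] symp_par_edges[of 0 n par] irreflp_par_edges[OF assms]
    by (fastforce simp: simple_graph_def symp_def irreflp_def)
  moreover have "connected_graph n ?E"
  proof -
    have up: "?E\<^sup>*\<^sup>* u 0 \<and> ?E\<^sup>*\<^sup>* 0 u" if "u < n" for u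
      using that
    proof (induction u rule: less_induct)
      case (less u)
      show ?case
      proof (cases "u = 0")
        case False
        then have p: "par u < u" using less assms by (auto simp: is_par_def)
        have "?E u (par u)" "?E (par u) u" using less False by (auto simp: par_edges_def)
        then show ?thesis using less.IH[OF p] p less.prems
          by (meson converse_rtranclp_into_rtranclp less_trans rtranclp.rtrancl_into_rtrancl)
      qed simp
    qed
    show ?thesis unfolding connected_graph_def using up by (meson rtranclp_trans)
  qed
  ultimately show ?thesis using par_edges_acyclic[OF assms] by (simp add: is_tree_def)
qed

text \<open>The flag \<open>b\<close> asks for a vertex of degree \<open>D\<close> other than the root. All offsets \<open>a\<close> are allowed,
  so that two trees can be placed on disjoint intervals before they are joined.\<close>

definition realizes :: "nat \<Rightarrow> nat \<Rightarrow> nat \<Rightarrow> bool \<Rightarrow> (real \<Rightarrow> real) \<Rightarrow> (real \<Rightarrow> real) \<Rightarrow> nat \<Rightarrow> (nat \<Rightarrow> nat) \<Rightarrow> bool" where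
  "realizes D n d b m m0 a par \<longleftrightarrow> is_par a n par \<and>
     card {u\<in>{a..<a+n}. par_edges a n par a u} = d \<and>
     (\<forall>v\<in>{a<..<a+n}. card {u\<in>{a..<a+n}. par_edges a n par v u} \<le> D) \<and>
     (b \<longrightarrow> (\<exists>v\<in>{a<..<a+n}. card {u\<in>{a..<a+n}. par_edges a n par v u} = D)) \<and>
     (\<forall>t>0. matching_sum (par_edges a n par) {a..<a+n} t \<le> m (t\<^sup>2) \<and>
            matching_sum (par_edges a n par) ({a..<a+n} - {a}) t \<le> m0 (t\<^sup>2))"

definition realizable :: "nat \<Rightarrow> nat \<Rightarrow> nat \<Rightarrow> bool \<Rightarrow> (real \<Rightarrow> real) \<Rightarrow> (real \<Rightarrow> real) \<Rightarrow> bool" where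
  "realizable D n d b m m0 \<longleftrightarrow> (\<forall>a. \<exists>par. realizes D n d b m m0 a par)"

lemma realizable_single: "realizable D 1 0 False (\<lambda>y. 1) (\<lambda>y. 1)"
proof -
  have "{a..<Suc a} = {a}" for a by auto
  moreover have "{u. u = a \<and> par_edges a (Suc 0) id a u} = {}" for a by (auto simp: par_edges_def)
  ultimately show ?thesis
    unfolding realizable_def realizes_def by (intro allI exI[of _ id]) (auto simp: is_par_def)
qed

text \<open>One bound \<open>m'\<close> serves the tree with and without its root, as deleting a
  vertex cannot increase the matching sum. Giving up the sharper second bound lets repeated gluing
  be tracked by a single product.\<close>

lemma realizable_mono:
  assumes "realizable D n d b m m0" "\<And>y. y > 0 \<Longrightarrow> m y \<le> m' y"
  shows "realizable D n d b m' m'"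
  unfolding realizable_def
proof
  fix a
  from assms(1) obtain par where "realizes D n d b m m0 a par"
    unfolding realizable_def by blast
  then have par: "is_par a n par"
     "card {u\<in>{a..<a+n}. par_edges a n par a u} = d"
     "\<forall>v\<in>{a<..<a+n}. card {u\<in>{a..<a+n}. par_edges a n par v u} \<le> D"
     "b \<longrightarrow> (\<exists>v\<in>{a<..<a+n}. card {u\<in>{a..<a+n}. par_edges a n par v u} = D)"
     "\<And>t. t > 0 \<Longrightarrow> matching_sum (par_edges a n par) {a..<a+n} t \<le> m (t\<^sup>2)"
    unfolding realizes_def by blast+
  have "a \<in> {a..<a+n}" using par(1) by (auto simp: is_par_def)
  then have "matching_sum (par_edges a n par) ({a..<a+n} - {a}) t \<le> matching_sum (par_edges a n par) {a..<a+n} t" for t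
    using par(1) by (intro matching_sum_remove_le symp_par_edges irreflp_par_edges) auto
  moreover have "matching_sum (par_edges a n par) {a..<a+n} t \<le> m' (t\<^sup>2)" if "t > 0" for t
    using order_trans[OF par(5)[OF that] assms(2)[of "t\<^sup>2"]] that by simp
  ultimately have "realizes D n d b m' m' a par"
    unfolding realizes_def using par(1-4) by (meson order_trans)
  then show "\<exists>par. realizes D n d b m' m' a par" by blast
qed

text \<open>The second tree is placed right after the first, at offset \<open>a + n\<close>, and its
  root becomes a child of \<open>a\<close>. That root then has degree \<open>Suc d'\<close>, hence
  the condition \<open>d' < D\<close> and the third way to attain \<open>D\<close>.\<close>

lemma realizable_join:
  assumes 1: "realizable D n d b m m0" and 2: "realizable D n' d' b' m' m0'" and "d' < D"
  shows "realizable D (n + n') (Suc d) (b \<or> b' \<or> Suc d' = D)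
    (\<lambda>y. m y * m' y + y * (m0 y * m0' y)) (\<lambda>y. m0 y * m' y)"
  unfolding realizable_def
proof
  fix a
  let ?c = "a + n" and ?V1 = "{a..<a+n}" and ?V2 = "{a+n..<a+n+n'}"
  let ?V = "{a..<a+(n+n')}"
  from 1 obtain par1 where "realizes D n d b m m0 a par1"
    unfolding realizable_def by blast
  then have par1: "is_par a n par1"
     "card {u\<in>?V1. par_edges a n par1 a u} = d"
     "\<And>v. v \<in> {a<..<a+n} \<Longrightarrow> card {u\<in>?V1. par_edges a n par1 v u} \<le> D"
     "b \<Longrightarrow> (\<exists>v\<in>{a<..<a+n}. card {u\<in>?V1. par_edges a n par1 v u} = D)"
     "\<And>t. t > 0 \<Longrightarrow> matching_sum (par_edges a n par1) ?V1 t \<le> m (t\<^sup>2)"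
     "\<And>t. t > 0 \<Longrightarrow> matching_sum (par_edges a n par1) (?V1 - {a}) t \<le> m0 (t\<^sup>2)"
    unfolding realizes_def by blast+
  from 2 obtain par2 where "realizes D n' d' b' m' m0' ?c par2"
    unfolding realizable_def by blast
  then have par2: "is_par ?c n' par2"
     "card {u\<in>?V2. par_edges ?c n' par2 ?c u} = d'"
     "\<And>v. v \<in> {?c<..<?c+n'} \<Longrightarrow> card {u\<in>?V2. par_edges ?c n' par2 v u} \<le> D"
     "b' \<Longrightarrow> (\<exists>v\<in>{?c<..<?c+n'}. card {u\<in>?V2. par_edges ?c n' par2 v u} = D)"
     "\<And>t. t > 0 \<Longrightarrow> matching_sum (par_edges ?c n' par2) ?V2 t \<le> m' (t\<^sup>2)"
     "\<And>t. t > 0 \<Longrightarrow> matching_sum (par_edges ?c n' par2) (?V2 - {?c}) t \<le> m0' (t\<^sup>2)"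
    unfolding realizes_def by blast+
  have n: "n \<ge> 1" "n' \<ge> 1" using par1(1) par2(1) by (auto simp: is_par_def)
  define par where "par u = (if u < ?c then par1 u else if u = ?c then a else par2 u)" for u
  let ?E = "par_edges a (n + n') par"
  have par1_lt: "a \<le> par1 u" "par1 u < u" if "a < u" "u < ?c" for u
    using par1(1) that by (auto simp: is_par_def)
  have par2_lt: "?c \<le> par2 u" "par2 u < u" if "?c < u" "u < ?c + n'" for u
    using par2(1) that by (auto simp: is_par_def)
  have P: "is_par a (n + n') par"
    unfolding is_par_def
  proof (intro conjI ballI)
    fix u assume u: "u \<in> {a<..<a+(n+n')}"
    consider "u < ?c" | "u = ?c" | "?c < u" by linarith
    then show "a \<le> par u" "par u < u"
      using u n par1_lt[of u] par2_lt[of u] by (cases, auto simp: par_def)+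
  qed (use n in simp)
  have E1: "?E u v \<longleftrightarrow> par_edges a n par1 u v" if "u \<in> ?V1" "v \<in> ?V1" for u v
    using that by (simp add: par_edges_def par_def)
  have E2: "?E u v \<longleftrightarrow> par_edges ?c n' par2 u v" if "u \<in> ?V2" "v \<in> ?V2" for u v
  proof -
    have "a < u" "a < v" using that n by auto
    then show ?thesis using that n par2_lt[of u] par2_lt[of v]
      by (cases "u = ?c"; cases "v = ?c") (auto simp: par_edges_def par_def)
  qed
  have E12: "?E u v \<longleftrightarrow> u = a \<and> v = ?c" if "u \<in> ?V1" "v \<in> ?V2" for u v
  proof -
    have uv: "a \<le> u" "u < ?c" "?c \<le> v" "v < ?c + n'" using that by auto
    have "v \<noteq> par u" if "a < u" using uv that par1_lt[of u] by (simp add: par_def)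
    moreover have "u = par v \<longleftrightarrow> u = a \<and> v = ?c"
      using uv par2_lt[of v] by (cases "v = ?c") (auto simp: par_def)
    moreover have "?E u v \<longleftrightarrow> (a < u \<and> v = par u) \<or> u = par v"
      using uv n by (simp add: par_edges_def)
    ultimately show ?thesis by blast
  qed
  have E21: "?E v u \<longleftrightarrow> u = a \<and> v = ?c" if "u \<in> ?V1" "v \<in> ?V2" for u v
    using E12[OF that] sympD[OF symp_par_edges] by metis
  have V: "?V = ?V1 \<union> ?V2" "?V1 \<inter> ?V2 = {}" by auto
  have in1: "a \<in> ?V1" and in2: "?c \<in> ?V2" using n by auto
  have dega: "card {u\<in>?V. ?E a u} = Suc d"
  proof -
    have "{u\<in>?V. ?E a u} = insert ?c {u\<in>?V1. par_edges a n par1 a u}"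
      unfolding V using E1[OF in1] E12[OF in1] in2 by blast
    then show ?thesis using par1(2) by simp
  qed
  have degc: "card {u\<in>?V. ?E ?c u} = Suc d'"
  proof -
    have "{u\<in>?V. ?E ?c u} = insert a {u\<in>?V2. par_edges ?c n' par2 ?c u}"
      unfolding V using E2[OF in2] E21[OF _ in2] in1 by blast
    then show ?thesis using par2(2) n by simp
  qed
  have deg1: "{u\<in>?V. ?E v u} = {u\<in>?V1. par_edges a n par1 v u}" if "v \<in> {a<..<a+n}" for v
  proof -
    have "v \<in> ?V1" "v \<noteq> a" using that by auto
    then show ?thesis unfolding V using E1 E12 by blast
  qed
  have deg2: "{u\<in>?V. ?E v u} = {u\<in>?V2. par_edges ?c n' par2 v u}" if "v \<in> {?c<..<?c+n'}" for v
  proof -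
    have "v \<in> ?V2" "v \<noteq> ?c" using that by auto
    then show ?thesis unfolding V using E2 E21 by blast
  qed
  have range: "v \<in> {a<..<a+n} \<or> v = ?c \<or> v \<in> {?c<..<?c+n'}" if "v \<in> {a<..<a+(n+n')}" for v
    using that by auto
  have sub: "{a<..<a+n} \<subseteq> {a<..<a+(n+n')}" "{?c<..<?c+n'} \<subseteq> {a<..<a+(n+n')}" "?c \<in> {a<..<a+(n+n')}"
    using n by auto
  have degle: "card {u\<in>?V. ?E v u} \<le> D" if "v \<in> {a<..<a+(n+n')}" for v
    using range[OF that]
  proof (elim disjE)
    assume "v \<in> {a<..<a+n}"
    then show ?thesis by (simp only: deg1 par1(3))
  next
    assume "v = ?c"
    with degc \<open>d' < D\<close> show ?thesis by (simp only: Suc_leI)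
  next
    assume "v \<in> {?c<..<?c+n'}"
    then show ?thesis by (simp only: deg2 par2(3))
  qed
  have attain: "\<exists>v\<in>{a<..<a+(n+n')}. card {u\<in>?V. ?E v u} = D" if "b \<or> b' \<or> Suc d' = D"
    using that
  proof (elim disjE)
    assume b
    then obtain v where v: "v \<in> {a<..<a+n}" "card {u\<in>?V1. par_edges a n par1 v u} = D" using par1(4) by blast
    show ?thesis by (rule bexI[of _ v]) (use v deg1[OF v(1)] sub(1) in \<open>simp_all only: subsetD\<close>)
  next
    assume b'
    then obtain v where v: "v \<in> {?c<..<?c+n'}" "card {u\<in>?V2. par_edges ?c n' par2 v u} = D" using par2(4) by blast
    show ?thesis by (rule bexI[of _ v]) (use v deg2[OF v(1)] sub(2) in \<open>simp_all only: subsetD\<close>)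
  next
    assume "Suc d' = D"
    with degc have "card {u\<in>?V. ?E ?c u} = D" by (simp only:)
    then show ?thesis using sub(3) by (rule bexI)
  qed
  have M: "matching_sum ?E ?V t \<le> m (t\<^sup>2) * m' (t\<^sup>2) + t\<^sup>2 * (m0 (t\<^sup>2) * m0' (t\<^sup>2)) \<and>
    matching_sum ?E (?V - {a}) t \<le> m0 (t\<^sup>2) * m' (t\<^sup>2)" if t: "t > 0" for t
  proof -
    have c: "matching_sum ?E ?V1 t = matching_sum (par_edges a n par1) ?V1 t"
      "matching_sum ?E (?V1 - {a}) t = matching_sum (par_edges a n par1) (?V1 - {a}) t"
      "matching_sum ?E ?V2 t = matching_sum (par_edges ?c n' par2) ?V2 t"
      "matching_sum ?E (?V2 - {?c}) t = matching_sum (par_edges ?c n' par2) (?V2 - {?c}) t"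
      by (intro matching_sum_cong E1 E2; simp)+
    have pos: "0 \<le> matching_sum (par_edges a' k q) V t" if "is_par a' k q" "finite V" for a' k q V
      using matching_sum_ge_1[OF that(2) symp_par_edges irreflp_par_edges[OF that(1)], of t] by simp
    have "matching_sum ?E ?V t = matching_sum ?E ?V1 t * matching_sum ?E ?V2 t
           + t\<^sup>2 * (matching_sum ?E (?V1 - {a}) t * matching_sum ?E (?V2 - {?c}) t)"
      unfolding V(1) by (intro matching_sum_bridge symp_par_edges irreflp_par_edges P V in1 in2 E12) auto
    also have "\<dots> \<le> m (t\<^sup>2) * m' (t\<^sup>2) + t\<^sup>2 * (m0 (t\<^sup>2) * m0' (t\<^sup>2))"
      unfolding c using par1(1,5,6) par2(1,5,6) t
      by (intro add_mono mult_mono mult_left_mono pos)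
         (auto intro: order_trans[OF pos par1(5)] order_trans[OF pos par1(6)])
    finally have A: "matching_sum ?E ?V t \<le> m (t\<^sup>2) * m' (t\<^sup>2) + t\<^sup>2 * (m0 (t\<^sup>2) * m0' (t\<^sup>2))" .
    have "?V - {a} = (?V1 - {a}) \<union> ?V2" using n by auto
    then have "matching_sum ?E (?V - {a}) t = matching_sum ?E (?V1 - {a}) t * matching_sum ?E ?V2 t"
      using E12 V(2) by (simp only:, intro matching_sum_disjoint_union symp_par_edges irreflp_par_edges P) auto
    also have "\<dots> \<le> m0 (t\<^sup>2) * m' (t\<^sup>2)"
      unfolding c using par1(1,5,6) par2(1,5,6) t
      by (intro mult_mono pos) (auto intro: order_trans[OF pos par1(6)])
    finally show ?thesis using A by simp
  qed
  have "realizes D (n + n') (Suc d) (b \<or> b' \<or> Suc d' = D)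
      (\<lambda>y. m y * m' y + y * (m0 y * m0' y)) (\<lambda>y. m0 y * m' y) a par"
    unfolding realizes_def using P dega degle attain M by blast
  then show "\<exists>par. realizes D (n + n') (Suc d) (b \<or> b' \<or> Suc d' = D)
      (\<lambda>y. m y * m' y + y * (m0 y * m0' y)) (\<lambda>y. m0 y * m' y) a par" by blast
qed

section \<open>Gluing stars at a leaf\<close>

definition root_product :: "real list \<Rightarrow> real \<Rightarrow> real" where
  "root_product bs y = (\<Prod>b\<leftarrow>bs. 1 + y * b\<^sup>2)"

text \<open>Root degree 1 makes the root a leaf, the place where the next star is glued. By
  Coulson's comparison \<open>e\<close> bounds the energy from above.\<close>

definition has_tree :: "nat \<Rightarrow> nat \<Rightarrow> real \<Rightarrow> bool" where
  "has_tree D n e \<longleftrightarrow> (\<exists>bs. realizable D n 1 True (root_product bs) (root_product bs) \<and> 2 * (\<Sum>b\<leftarrow>bs. \<bar>b\<bar>) \<le> e)"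

lemma strongly_hypoenergetic_of_has_tree:
  assumes "has_tree D n e" "e < real n - 1" "D \<ge> 1"
  shows "\<exists>E. is_tree n E \<and> strongly_hypoenergetic n E \<and> max_degree n E = D"
proof -
  obtain bs where bs: "realizable D n 1 True (root_product bs) (root_product bs)" "2 * (\<Sum>b\<leftarrow>bs. \<bar>b\<bar>) \<le> e"
    using assms(1) by (auto simp: has_tree_def)
  then obtain par where "realizes D n 1 True (root_product bs) (root_product bs) 0 par"
    unfolding realizable_def by blast
  then have par: "is_par 0 n par"
     "card {u\<in>{0..<0+n}. par_edges 0 n par 0 u} = 1"
     "\<forall>v\<in>{0<..<0+n}. card {u\<in>{0..<0+n}. par_edges 0 n par v u} \<le> D"
     "\<exists>v\<in>{0<..<0+n}. card {u\<in>{0..<0+n}. par_edges 0 n par v u} = D"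
     "\<And>t. t > 0 \<Longrightarrow> matching_sum (par_edges 0 n par) {0..<0+n} t \<le> root_product bs (t\<^sup>2)"
    unfolding realizes_def by blast+
  let ?E = "par_edges 0 n par"
  have tree: "is_tree n ?E" by (rule is_tree_par_edges[OF par(1)])
  have deg: "degree n ?E v = card {u\<in>{0..<0+n}. ?E v u}" for v
    by (simp add: degree_def)
  have "energy n ?E \<le> 2 * (\<Sum>b\<leftarrow>bs. \<bar>b\<bar>)"
    using tree par(5) by (intro energy_le_of_matching_sum_le) (auto simp: is_tree_def root_product_def)
  then have "strongly_hypoenergetic n ?E"
    using tree bs(2) assms(2) by (simp add: strongly_hypoenergetic_def is_tree_def)
  moreover have "max_degree n ?E = D"
    unfolding max_degree_def
  proof (rule Max_eqI)
    fix y assume "y \<in> degree n ?E ` {0..<n}"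
    then obtain v where v: "v < n" "y = degree n ?E v" by auto
    show "y \<le> D"
      using v par(2,3) deg[of v] \<open>D \<ge> 1\<close> by (cases "v = 0") auto
  next
    show "D \<in> degree n ?E ` {0..<n}"
      using par(4) deg by (metis (no_types, lifting) add_0 atLeastLessThan_iff greaterThanLessThan_iff image_eqI le0)
  qed simp
  ultimately show ?thesis using tree by blast
qed

lemma realizable_weaken: "realizable D n d b m m0 \<Longrightarrow> (b' \<longrightarrow> b) \<Longrightarrow> realizable D n d b' m m0"
  unfolding realizable_def realizes_def by blast

lemma realizable_star:
  assumes "D \<ge> 2"
  shows "realizable D (Suc k) k False (\<lambda>y. 1 + k * y) (\<lambda>y. 1)"
proof (induction k)
  case 0
  show ?case using realizable_single[of D] by simp
next
  case (Suc k)
  have "realizable D (Suc k + 1) (Suc k) (False \<or> False \<or> Suc 0 = D)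
     (\<lambda>y. (1 + k * y) * 1 + y * (1 * 1)) (\<lambda>y. 1 * 1)"
    using assms by (intro realizable_join Suc realizable_single) auto
  then show ?case using assms by (auto simp: algebra_simps elim!: realizable_weaken)
qed

text \<open>The old root becomes one leaf of the star, another leaf is the new root, and the other
  \<open>k - 2\<close> hang from the centre; for \<open>k = 1\<close> only a new root is put on top.
  At most one star edge is in a matching, and each choice leaves at most the matchings of the old
  tree, hence the factor \<open>1 + k * y\<close>.\<close>

lemma realizable_attach_star:
  assumes T: "realizable D n d b m m" and "d < D" "1 \<le> k" "k \<le> D" "D \<ge> 2"
  shows "realizable D (n + k) 1 (b \<or> k = D) (\<lambda>y. (1 + k * y) * m y) (\<lambda>y. (1 + k * y) * m y)"
proof (cases "k = 1")
  case True
  have "realizable D (1 + n) (Suc 0) (False \<or> b \<or> Suc d = D) (\<lambda>y. 1 * m y + y * (1 * m y)) (\<lambda>y. 1 * m y)"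
    by (intro realizable_join realizable_single T assms)
  then have "realizable D (1 + n) (Suc 0) (False \<or> b \<or> Suc d = D) (\<lambda>y. (1 + k * y) * m y) (\<lambda>y. (1 + k * y) * m y)"
    by (rule realizable_mono) (simp add: True algebra_simps)
  then show ?thesis using True assms by (auto elim!: realizable_weaken)
next
  case False
  then obtain l where l: "k = l + 2" using assms(3) by (metis One_nat_def Suc_1 add.commute add_Suc_right le_SucE le_add_diff_inverse le_antisym not_less_eq_eq plus_1_eq_Suc)
  have star: "realizable D (Suc l) l False (\<lambda>y. 1 + l * y) (\<lambda>y. 1)"
    using assms by (intro realizable_star)
  have "realizable D (1 + (Suc l + n)) (Suc 0) (False \<or> (False \<or> b \<or> Suc d = D) \<or> Suc (Suc l) = D)
     (\<lambda>y. 1 * ((1 + l * y) * m y + y * (1 * m y)) + y * (1 * (1 * m y))) (\<lambda>y. 1 * ((1 + l * y) * m y + y * (1 * m y)))"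
    using assms l by (intro realizable_join realizable_single star T) auto
  then have "realizable D (1 + (Suc l + n)) (Suc 0) (False \<or> (False \<or> b \<or> Suc d = D) \<or> Suc (Suc l) = D)
    (\<lambda>y. (1 + k * y) * m y) (\<lambda>y. (1 + k * y) * m y)"
    by (rule realizable_mono) (simp add: l algebra_simps)
  then have "realizable D (1 + (Suc l + n)) (Suc 0) (b \<or> k = D)
    (\<lambda>y. (1 + k * y) * m y) (\<lambda>y. (1 + k * y) * m y)"
    by (rule realizable_weaken) (use l in auto)
  moreover have "1 + (Suc l + n) = n + k" using l by simp
  ultimately show ?thesis by (simp only: One_nat_def)
qed

lemma has_tree_star:
  assumes "D \<ge> 2"
  shows "has_tree D (Suc D) (2 * sqrt D)"
proof -
  have "realizable D (1 + D) 1 (False \<or> D = D) (\<lambda>y. (1 + D * y) * 1) (\<lambda>y. (1 + D * y) * 1)"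
    using assms by (intro realizable_attach_star[OF realizable_single]) auto
  then show ?thesis
    unfolding has_tree_def by (intro exI[of _ "[sqrt D]"]) (simp add: root_product_def[abs_def] mult.commute)
qed

lemma has_tree_attach_star:
  assumes "has_tree D n e" "1 \<le> k" "k \<le> D" "D \<ge> 2"
  shows "has_tree D (n + k) (e + 2 * sqrt k)"
proof -
  obtain bs where bs: "realizable D n 1 True (root_product bs) (root_product bs)" "2 * (\<Sum>b\<leftarrow>bs. \<bar>b\<bar>) \<le> e"
    using assms(1) by (auto simp: has_tree_def)
  have "realizable D (n + k) 1 (True \<or> k = D) (\<lambda>y. (1 + k * y) * root_product bs y) (\<lambda>y. (1 + k * y) * root_product bs y)"
    using assms by (intro realizable_attach_star[OF bs(1)]) auto
  then show ?thesis
    unfolding has_tree_def using bs(2)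
    by (intro exI[of _ "sqrt k # bs"]) (simp add: root_product_def[abs_def] mult.commute)
qed

lemma has_tree_attach_4:
  assumes "has_tree D n e" "D \<ge> 4"
  shows "has_tree D (n + 4 * q) (e + 4 * q)"
proof (induction q)
  case (Suc q)
  show ?case using has_tree_attach_star[OF Suc, of 4] assms(2) by (simp add: algebra_simps)
qed (use assms in simp)

section \<open>Strongly hypoenergetic trees\<close>

text \<open>For each order, the positive eigenvalues of the tree of minimal energy, rounded down.\<close>

lemma certificates_4:
  "certificates 4 (table 4 21)
     [(5, 10, [20]), (6, 10, [8, 20]), (7, 10, [11, 21]), (8, 10, [13, 23]), (10, 10, [7, 17, 23]),
      (11, 10, [10, 17, 24]), (12, 50, [62, 96, 119]), (14, 10, [6, 17, 17, 25]), (15, 10, [9, 17, 19, 25]),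
      (16, 100, [121, 173, 204, 252]), (18, 50, [29, 86, 86, 98, 129]), (19, 50, [44, 86, 86, 105, 129]),
      (22, 100, [52, 173, 173, 173, 214, 266])]"
  \<comment> \<open>The star of order 5 meets the bound exactly. Finer denominators than 10 appear
    where rounding down to tenths would drop twice the sum below \<open>n - 1\<close>.\<close>
  by code_simp

lemma certificates_5: "certificates 5 (table 5 7) [(7, 10, [8, 22]), (8, 20, [23, 47])]"
  by code_simp

lemma certificates_exclude_strongly_hypoenergetic:
  assumes cert: "certificates D (table D N) xs" and n: "n \<in> fst ` set xs" "2 \<le> n" "n \<le> Suc N" and "D \<ge> 1"
  shows "\<not> (\<exists>E. is_tree n E \<and> strongly_hypoenergetic n E \<and> max_degree n E = D)"
proof
  assume "\<exists>E. is_tree n E \<and> strongly_hypoenergetic n E \<and> max_degree n E = D"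
  then obtain E where E: "is_tree n E" "energy n E < real n - 1" "max_degree n E = D"
    by (auto simp: strongly_hypoenergetic_def)
  obtain q ps where "(n, q, ps) \<in> set xs" using n(1) by auto
  from energy_lower_bound[OF E(1) _ \<open>D \<ge> 1\<close> n(2) certificates_sound[OF cert this n(3)]] E
  show False by simp
qed

text \<open>Size, degree, flag and polynomials are separate premises, so that a tree can be stated
  with explicit numerals and checked by simplification.\<close>

lemma realizable_pjoin:
  assumes "realizable D n d b (peval (fst A)) (peval (snd A))"
    and "realizable D n' d' b' (peval (fst B)) (peval (snd B))"
    and "d' < D" "N = n + n'" "k = Suc d" "b'' \<longrightarrow> b \<or> b' \<or> Suc d' = D" "C = pjoin A B"
  shows "realizable D N k b'' (peval (fst C)) (peval (snd C))"
proof -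
  have "peval (fst C) = (\<lambda>y. peval (fst A) y * peval (fst B) y + y * (peval (snd A) y * peval (snd B) y))"
    "peval (snd C) = (\<lambda>y. peval (snd A) y * peval (fst B) y)"
    unfolding assms(7) by (cases A; cases B; auto)+
  then show ?thesis
    using realizable_weaken[OF realizable_join[OF assms(1-3)] assms(6)] assms(4,5) by simp
qed

lemma has_tree_of_root_poly:
  assumes tree: "realizable D n 1 True (peval (fst A)) (peval (snd A))"
    and q: "q > 0" and ps: "list_all ((\<le>) 0) ps"
    and le: "ple (map ((*) (q ^ (2 * length ps))) (fst A)) (root_poly q ps)"
  shows "has_tree D n (2 * (of_int (sum_list ps) / of_int q))"
proof -
  define bs where "bs = map (\<lambda>p. real_of_int p / real_of_int q) ps"
  have "peval (fst A) y \<le> root_product bs y" if "y > 0" for y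
  proof -
    have "of_int q ^ (2 * length ps) * peval (fst A) y \<le> of_int q ^ (2 * length ps) * root_product bs y"
      using peval_ple[OF _ le, of y] that by (simp add: peval_root_poly[OF q] bs_def root_product_def o_def)
    then show ?thesis using q by simp
  qed
  then have "realizable D n 1 True (root_product bs) (root_product bs)"
    by (rule realizable_mono[OF tree])
  moreover have "(\<Sum>b\<leftarrow>bs. \<bar>b\<bar>) = of_int (sum_list ps) / of_int q"
    unfolding bs_def using ps q by (induction ps) (auto simp: add_divide_distrib)
  ultimately show ?thesis unfolding has_tree_def by (intro exI[of _ bs]) simp
qed

text \<open>One tree for each residue class modulo 4; again the numbers are the positive eigenvalues, now
  rounded up.\<close>

lemma has_tree_4_bases:
  "has_tree 4 9 (2 * (399 / 100))" "has_tree 4 20 (2 * (474 / 50))"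
  "has_tree 4 23 (2 * (3298 / 300))" "has_tree 4 26 (2 * (1249 / 100))"
proof -
  let ?R = "\<lambda>n d b A. realizable 4 n d b (peval (fst A)) (peval (snd A))"
  have leaf: "?R 1 0 False ([1], [1])"
  proof -
    have "peval [1] = (\<lambda>y. 1)" by (simp add: fun_eq_iff)
    then show ?thesis using realizable_single[of 4] by simp
  qed
  have c1: "?R 2 1 False ([1, 1], [1])"
    by (rule realizable_pjoin[OF leaf leaf]) simp_all
  have c2: "?R 3 2 False ([1, 2], [1])"
    by (rule realizable_pjoin[OF c1 leaf]) simp_all
  have S: "?R 4 3 False ([1, 3], [1])"
    by (rule realizable_pjoin[OF c2 leaf]) simp_all
  have W: "?R 5 1 True ([1, 4], [1, 3])"
    by (rule realizable_pjoin[OF leaf S]) simp_all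
  have X: "?R 8 3 True ([1, 7, 11], [1, 4])"
    by (rule realizable_pjoin[OF c2 W]) simp_all
  \<comment> \<open>Two stars with 4 edges that share a leaf, rooted at another leaf.\<close>
  have T9: "?R 9 1 True ([1, 8, 15], [1, 7, 11])"
    by (rule realizable_pjoin[OF leaf X]) simp_all
  have P2: "?R 9 2 True ([1, 8, 15], [1, 6, 9])"
    by (rule realizable_pjoin[OF W S]) simp_all
  have B: "?R 13 3 True ([1, 12, 45, 54], [1, 9, 27, 27])"
    by (rule realizable_pjoin[OF P2 S]) simp_all
  have Q: "?R 6 2 True ([1, 5, 3], [1, 3])"
    by (rule realizable_pjoin[OF c1 S]) simp_all
  have A1: "?R 19 3 True ([1, 18, 120, 369, 513, 243], [1, 15, 81, 189, 162])"
    by (rule realizable_pjoin[OF Q B]) simp_all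
  have A2: "?R 22 3 True ([1, 21, 171, 684, 1377, 1215, 243], [1, 18, 126, 432, 729, 486])"
    by (rule realizable_pjoin[OF P2 B]) simp_all
  have A3: "?R 25 3 True ([1, 24, 231, 1152, 3177, 4698, 3159, 486], [1, 21, 171, 684, 1377, 1215, 243])"
    by (rule realizable_pjoin[OF c2 A2]) simp_all
  \<comment> \<open>Up to the choice of root, \<open>T26\<close> is a pair of adjacent vertices,
    each joined to the centres of three copies of \<open>S\<close>. Replacing one copy by a single
    leaf gives \<open>T23\<close>; replacing two copies at the same vertex gives
    \<open>T20\<close>.\<close>
  have T20: "?R 20 1 True ([1, 19, 135, 450, 702, 405], [1, 18, 120, 369, 513, 243])"
    by (rule realizable_pjoin[OF leaf A1]) simp_all
  have T23: "?R 23 1 True ([1, 22, 189, 810, 1809, 1944, 729], [1, 21, 171, 684, 1377, 1215, 243])"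
    by (rule realizable_pjoin[OF leaf A2]) simp_all
  have T26: "?R 26 1 True ([1, 25, 252, 1323, 3861, 6075, 4374, 729], [1, 24, 231, 1152, 3177, 4698, 3159, 486])"
    by (rule realizable_pjoin[OF leaf A3]) simp_all
  show "has_tree 4 9 (2 * (399 / 100))"
    using has_tree_of_root_poly[OF T9, of 100 "[175, 224]"] by simp
  show "has_tree 4 20 (2 * (474 / 50))"
    using has_tree_of_root_poly[OF T20, of 50 "[60, 87, 87, 105, 135]"] by simp
  \<comment> \<open>Rounding up to hundredths would give 22.04, above the limit 22 for order 23;
    hence the denominator 300.\<close>
  show "has_tree 4 23 (2 * (3298 / 300))"
    using has_tree_of_root_poly[OF T23, of 300 "[261, 520, 520, 520, 658, 819]"] by simp
  show "has_tree 4 26 (2 * (1249 / 100))"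
    using has_tree_of_root_poly[OF T26, of 100 "[49, 174, 174, 174, 174, 226, 278]"] by simp
qed

lemma strongly_hypoenergetic_of_base:
  assumes "has_tree D k e" "e < real k - 1" "D \<ge> 4" "k \<le> n" "n mod 4 = k mod 4"
  shows "\<exists>E. is_tree n E \<and> strongly_hypoenergetic n E \<and> max_degree n E = D"
proof -
  have "4 dvd n - k" using assms(4,5) by (simp add: mod_eq_dvd_iff_nat)
  then obtain q where n: "n = k + 4 * q" using assms(4) by (metis dvdE le_add_diff_inverse)
  show ?thesis
    unfolding n by (rule strongly_hypoenergetic_of_has_tree[OF has_tree_attach_4[OF assms(1,3)]]) (use assms in auto)
qed

theorem theorem2p6:
  shows "(\<forall>n::nat. n \<ge> 5 \<longrightarrow>
           ((\<exists>E. is_tree n E \<and> strongly_hypoenergetic n E \<and> max_degree n E = 4) \<longleftrightarrow>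
            (n \<in> {9, 13, 17, 20, 21} \<or> n \<ge> 23)))
       \<and> (\<forall>n::nat. n \<ge> 6 \<longrightarrow>
           ((\<exists>E. is_tree n E \<and> strongly_hypoenergetic n E \<and> max_degree n E = 5) \<longleftrightarrow>
            (n = 6 \<or> n \<ge> 9)))
       \<and> (\<forall>\<Delta> n::nat. \<Delta> \<ge> 6 \<longrightarrow> n \<ge> \<Delta> + 1 \<longrightarrow>
           (\<exists>E. is_tree n E \<and> strongly_hypoenergetic n E \<and> max_degree n E = \<Delta>))"
proof (intro conjI allI impI)
  fix n :: nat assume n: "n \<ge> 5"
  show "(\<exists>E. is_tree n E \<and> strongly_hypoenergetic n E \<and> max_degree n E = 4) \<longleftrightarrow>
            (n \<in> {9, 13, 17, 20, 21} \<or> n \<ge> 23)"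
  proof (cases "n \<in> {9, 13, 17, 20, 21} \<or> n \<ge> 23")
    case True
    then have "n = 9 \<or> n = 13 \<or> n = 17 \<or> n = 20 \<or> n = 21 \<or> n \<ge> 23" by simp
    \<comment> \<open>Order 22 is an exception, so the residue class of 2 starts only at 26.\<close>
    then have "(9 \<le> n \<and> n mod 4 = 1) \<or> (20 \<le> n \<and> n mod 4 = 0) \<or> (23 \<le> n \<and> n mod 4 = 3) \<or> (26 \<le> n \<and> n mod 4 = 2)"
      by presburger
    then have "\<exists>E. is_tree n E \<and> strongly_hypoenergetic n E \<and> max_degree n E = 4"
      by (elim disjE conjE)
        (rule strongly_hypoenergetic_of_base[OF has_tree_4_bases(1)]
          strongly_hypoenergetic_of_base[OF has_tree_4_bases(2)]
          strongly_hypoenergetic_of_base[OF has_tree_4_bases(3)]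
          strongly_hypoenergetic_of_base[OF has_tree_4_bases(4)]; simp; fail)+
    then show ?thesis using True by simp
  next
    case False
    then have "n \<in> {5, 6, 7, 8, 10, 11, 12, 14, 15, 16, 18, 19, 22}" using n by simp presburger
    then have "\<not> (\<exists>E. is_tree n E \<and> strongly_hypoenergetic n E \<and> max_degree n E = 4)"
      by (intro certificates_exclude_strongly_hypoenergetic[OF certificates_4]) auto
    then show ?thesis using False by simp
  qed
next
  fix n :: nat assume n: "n \<ge> 6"
  show "(\<exists>E. is_tree n E \<and> strongly_hypoenergetic n E \<and> max_degree n E = 5) \<longleftrightarrow> (n = 6 \<or> n \<ge> 9)"
  proof (cases "n = 6 \<or> n \<ge> 9")
    case True
    have s5: "sqrt 5 < 2.24" and s3: "sqrt 3 < 1.74" by (rule real_less_lsqrt; simp add: power2_eq_square)+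
    have t6: "has_tree 5 6 (2 * sqrt 5)" using has_tree_star[of 5] by simp
    \<comment> \<open>The star of order 6 has slack \<open>5 - 2 * sqrt 5\<close>, about 0.53. This
      pays for 3 more edges, at cost \<open>2 * sqrt 3 - 3\<close>, about 0.46, but not for 1 or 2,
      at costs 1 and about 0.83. A second star with 5 edges doubles the slack, which then pays for a
      single edge.\<close>
    have t9: "has_tree 5 9 (2 * sqrt 5 + 2 * sqrt 3)" using has_tree_attach_star[OF t6, of 3] by simp
    have t11: "has_tree 5 11 (2 * sqrt 5 + 2 * sqrt 5)" using has_tree_attach_star[OF t6, of 5] by simp
    have t12: "has_tree 5 12 (2 * sqrt 5 + 2 * sqrt 5 + 2)" using has_tree_attach_star[OF t11, of 1] by simp
    from True have "(6 \<le> n \<and> n mod 4 = 2) \<or> (9 \<le> n \<and> n mod 4 = 1) \<or> (11 \<le> n \<and> n mod 4 = 3) \<or> (12 \<le> n \<and> n mod 4 = 0)"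
      by presburger
    then have "\<exists>E. is_tree n E \<and> strongly_hypoenergetic n E \<and> max_degree n E = 5"
    proof (elim disjE conjE)
      assume "6 \<le> n" "n mod 4 = 2"
      then show ?thesis using s5 s3 by (intro strongly_hypoenergetic_of_base[OF t6]) auto
    next
      assume "9 \<le> n" "n mod 4 = 1"
      then show ?thesis using s5 s3 by (intro strongly_hypoenergetic_of_base[OF t9]) auto
    next
      assume "11 \<le> n" "n mod 4 = 3"
      then show ?thesis using s5 s3 by (intro strongly_hypoenergetic_of_base[OF t11]) auto
    next
      assume "12 \<le> n" "n mod 4 = 0"
      then show ?thesis using s5 s3 by (intro strongly_hypoenergetic_of_base[OF t12]) auto
    qed
    then show ?thesis using True by simp
  next
    case False
    then have "n \<in> {7, 8}" using n by auto
    then have "\<not> (\<exists>E. is_tree n E \<and> strongly_hypoenergetic n E \<and> max_degree n E = 5)"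
      by (intro certificates_exclude_strongly_hypoenergetic[OF certificates_5]) auto
    then show ?thesis using False by simp
  qed
next
  fix \<Delta> n :: nat assume D: "\<Delta> \<ge> 6" and n: "n \<ge> \<Delta> + 1"
  have t1: "has_tree \<Delta> (\<Delta> + 1) (2 * sqrt \<Delta>)" using has_tree_star[of \<Delta>] D by simp
  have t2: "has_tree \<Delta> (\<Delta> + 2) (2 * sqrt \<Delta> + 2)" using has_tree_attach_star[OF t1, of 1] D by simp
  have t3: "has_tree \<Delta> (\<Delta> + 3) (2 * sqrt \<Delta> + 2 * sqrt 2)" using has_tree_attach_star[OF t1, of 2] D by (simp add: numeral_3_eq_3)
  have t4: "has_tree \<Delta> (\<Delta> + 4) (2 * sqrt \<Delta> + 2 * sqrt 3)" using has_tree_attach_star[OF t1, of 3] D by (simp add: add.commute)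
  have s2: "sqrt 2 < 1.5" and s3: "sqrt 3 < 1.74" by (rule real_less_lsqrt; simp add: power2_eq_square)+
  \<comment> \<open>Attaching at most 3 edges costs at most 1 of the slack
    \<open>\<Delta> - 2 * sqrt \<Delta>\<close>, the worst case being one edge. Slack above 1 means
    \<open>\<Delta>^2 - 6 * \<Delta> + 1 > 0\<close>, which holds from 6 on and fails at 5.\<close>
  have sD: "sqrt \<Delta> < (real \<Delta> - 1) / 2"
  proof (rule real_less_lsqrt)
    have "0 \<le> real \<Delta> * (real \<Delta> - 6)" using D by (intro mult_nonneg_nonneg) auto
    then show "real \<Delta> < ((real \<Delta> - 1) / 2)\<^sup>2" by (simp add: power2_eq_square field_simps)
  qed (use D in auto)
  from n consider "n mod 4 = (\<Delta> + 1) mod 4" | "\<Delta> + 2 \<le> n" "n mod 4 = (\<Delta> + 2) mod 4"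
    | "\<Delta> + 3 \<le> n" "n mod 4 = (\<Delta> + 3) mod 4" | "\<Delta> + 4 \<le> n" "n mod 4 = (\<Delta> + 4) mod 4"
  proof -
    obtain k where k: "n = \<Delta> + 1 + k" using n le_Suc_ex by blast
    define r where "r = k mod 4"
    have r: "n mod 4 = (\<Delta> + 1 + r) mod 4" unfolding k r_def by (simp only: mod_add_right_eq)
    have "r \<le> k" "r < 4" by (auto simp: r_def)
    then consider "r = 0" | "r = 1" | "r = 2" | "r = 3" by linarith
    then show ?thesis
    proof cases
      case 1
      then show ?thesis using that(1) r by simp
    next
      case 2
      then show ?thesis using that(2) r k \<open>r \<le> k\<close> by (simp add: add.assoc)
    next
      case 3
      then show ?thesis using that(3) r k \<open>r \<le> k\<close> by (simp add: add_ac)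
    next
      case 4
      then show ?thesis using that(4) r k \<open>r \<le> k\<close> by (simp add: add.assoc)
    qed
  qed
  then show "\<exists>E. is_tree n E \<and> strongly_hypoenergetic n E \<and> max_degree n E = \<Delta>"
  proof cases
    case 1
    then show ?thesis using n sD D by (intro strongly_hypoenergetic_of_base[OF t1]) auto
  next
    case 2
    then show ?thesis using sD D by (intro strongly_hypoenergetic_of_base[OF t2]) auto
  next
    case 3
    then show ?thesis using s2 sD D by (intro strongly_hypoenergetic_of_base[OF t3]) auto
  next
    case 4
    then show ?thesis using s3 sD D by (intro strongly_hypoenergetic_of_base[OF t4]) auto
  qed
qed

end
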